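(* Let $w=(w(n))_{n\in\mathbb{N}}$ be a nonnegative weight sequence and let $\psi(n)=n/\phi_{\gamma_{1,w}}(n)$ for every $n\in\mathbb{N}$. The Marcinkiewicz space $m_\psi^0$ is the predual of the sequence Lorentz space $\gamma_{1,w}$ if and only if $W(\infty)=\infty$. Additionally, if $W(\infty)=\infty$, then there exists an isometry between $\gamma_{1,w}$ and the dual space $(m_\psi^0)^*$ of $m_\psi^0$.
   Context: $\mathbb{N}$ is the set of positive integers and $\ell^0$ is the set of all real sequences. For $x\in\ell^0$ put $d_x(\lambda)=\operatorname{card}\{k\in\mathbb{N}:|x(k)|>\lambda\}$ for $\lambda\ge 0$, $x^*(n)=\inf\{\lambda\ge 0: d_x(\lambda)\le n-1\}$ (decreasing rearrangement) and $x^{**}(n)=\frac1n\sum_{i=1}^n x^*(i)$ for $n\in\mathbb{N}$. A nonnegative weight sequence is a sequence $w=(w(n))_{n\in\mathbb{N}}$ of nonnegative reals, with $w(n)>0$ for at least one $n$, such that $W_1(n)=n\sum_{i=n+1}^\infty \frac{w(i)}{i}<\infty$ for every $n\in\mathbb{N}$. Put $W(n)=\sum_{i=1}^n w(i)$ and $W(\infty)=\sum_{i=1}^\infty w(i)\in(0,\infty]$. The sequence Lorentz space $\gamma_{1,w}$ is the Banach space of all $x\in\ell^0$ with $\|x\|_{\gamma_{1,w}}=\sum_{n=1}^\infty x^{**}(n) w(n)<\infty$. Its fundamental sequence is $\phi_{\gamma_{1,w}}(n)=\|\chi_{\{i\in\mathbb{N}:i\le n\}}\|_{\gamma_{1,w}}=W(n)+W_1(n)$,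 $n\in\mathbb{N}$. The Marcinkiewicz space $m_\psi$ is the Banach space of all $y\in\ell^0$ with $\|y\|_{m_\psi}=\sup_{n\in\mathbb{N}} y^{**}(n)\psi(n)<\infty$, and $m_\psi^0$ is the subspace of those $y\in m_\psi$ with $\lim_{n\to\infty}y^{**}(n)\psi(n)=0$, with the norm $\|\cdot\|_{m_\psi}$. A Banach space $X$ is a predual of a Banach space $Y$ if the Banach dual $X^*$ is isomorphic to $Y$; an isometry between two Banach spaces means a linear surjective isometry. *)

theory Defs
  imports "HOL-Library.Extended_Nonnegative_Real"
begin

text \<open>
  Sequences are indexed by the positive integers. They are represented by functions on \<open>nat\<close>;
  elements of the sequence spaces are required to vanish at index 0, so that each
  sequence has exactly one representative, and no definition depends on \<open>w 0\<close> or \<open>\<psi> 0\<close>.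
\<close>

definition l0 :: "(nat \<Rightarrow> real) set" where
  "l0 = {x. x 0 = 0}"

definition distr :: "(nat \<Rightarrow> real) \<Rightarrow> real \<Rightarrow> enat" where
  "distr x t = (let A = {k. k \<ge> 1 \<and> \<bar>x k\<bar> > t} in if finite A then enat (card A) else \<infinity>)"

text \<open>
  The infimum is taken in \<open>[0, \<infinity>]\<close>: it is \<open>\<infinity>\<close> when no admissible \<open>t\<close> exists, which
  happens exactly for unbounded sequences.
\<close>

definition rearr :: "(nat \<Rightarrow> real) \<Rightarrow> nat \<Rightarrow> ennreal" where
  "rearr x n = Inf {ennreal t | t. t \<ge> 0 \<and> distr x t \<le> enat (n - 1)}"

definition max_rearr :: "(nat \<Rightarrow> real) \<Rightarrow> nat \<Rightarrow> ennreal" where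
  "max_rearr x n = (\<Sum>i=1..n. rearr x i) / of_nat n"

definition W1 :: "(nat \<Rightarrow> real) \<Rightarrow> nat \<Rightarrow> ennreal" where
  "W1 w n = of_nat n * (\<Sum>j. ennreal (w (n + 1 + j) / real (n + 1 + j)))"

definition weight_seq :: "(nat \<Rightarrow> real) \<Rightarrow> bool" where
  "weight_seq w \<longleftrightarrow>
     (\<forall>n\<ge>1. w n \<ge> 0) \<and> (\<exists>n\<ge>1. w n > 0) \<and> (\<forall>n\<ge>1. W1 w n < \<infinity>)"

definition W_infinity :: "(nat \<Rightarrow> real) \<Rightarrow> ennreal" where
  "W_infinity w = (\<Sum>j. ennreal (w (j + 1)))"

text \<open>
  A normed space of real functions on a type, with pointwise operations: its set of vectors and
  its norm (only the values of \<open>nrm\<close> on \<open>vecs\<close> matter). Sequence spaces and their duals are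
  both of this form.
\<close>

record 'a fun_space =
  vecs :: "('a \<Rightarrow> real) set"
  nrm :: "('a \<Rightarrow> real) \<Rightarrow> real"

definition linear_functional_on :: "('a \<Rightarrow> real) set \<Rightarrow> (('a \<Rightarrow> real) \<Rightarrow> real) \<Rightarrow> bool" where
  "linear_functional_on V f \<longleftrightarrow>
     (\<forall>x\<in>V. \<forall>y\<in>V. f (\<lambda>k. x k + y k) = f x + f y) \<and>
     (\<forall>c. \<forall>x\<in>V. f (\<lambda>k. c * x k) = c * f x)"

definition linear_map_on ::
    "('a \<Rightarrow> real) set \<Rightarrow> (('a \<Rightarrow> real) \<Rightarrow> ('b \<Rightarrow> real)) \<Rightarrow> bool" where
  "linear_map_on V T \<longleftrightarrow>
     (\<forall>x\<in>V. \<forall>y\<in>V. T (\<lambda>k. x k + y k) = (\<lambda>k. T x k + T y k)) \<and>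
     (\<forall>c. \<forall>x\<in>V. T (\<lambda>k. c * x k) = (\<lambda>k. c * T x k))"

text \<open>
  Functionals on \<open>vecs X\<close> are extended by 0 to all functions, so that equality of functionals is
  equality of HOL functions.
\<close>

definition dual_space :: "'a fun_space \<Rightarrow> ('a \<Rightarrow> real) fun_space" where
  "dual_space X =
     \<lparr>vecs = {f. linear_functional_on (vecs X) f \<and>
                 (\<exists>C. \<forall>x\<in>vecs X. \<bar>f x\<bar> \<le> C * nrm X x) \<and> (\<forall>x. x \<notin> vecs X \<longrightarrow> f x = 0)},
      nrm = (\<lambda>f. Sup {\<bar>f x\<bar> | x. x \<in> vecs X \<and> nrm X x \<le> 1})\<rparr>"

definition isomorphism_between ::
    "'a fun_space \<Rightarrow> 'b fun_space \<Rightarrow> (('a \<Rightarrow> real) \<Rightarrow> ('b \<Rightarrow> real)) \<Rightarrow> bool" where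
  "isomorphism_between X Y T \<longleftrightarrow>
     linear_map_on (vecs X) T \<and> bij_betw T (vecs X) (vecs Y) \<and>
     (\<exists>C. \<forall>x\<in>vecs X. nrm Y (T x) \<le> C * nrm X x) \<and>
     (\<exists>C. \<forall>x\<in>vecs X. nrm X x \<le> C * nrm Y (T x))"

definition isometry_between ::
    "'a fun_space \<Rightarrow> 'b fun_space \<Rightarrow> (('a \<Rightarrow> real) \<Rightarrow> ('b \<Rightarrow> real)) \<Rightarrow> bool" where
  "isometry_between X Y T \<longleftrightarrow>
     linear_map_on (vecs X) T \<and> T ` vecs X = vecs Y \<and>
     (\<forall>x\<in>vecs X. nrm Y (T x) = nrm X x)"

definition predual :: "'a fun_space \<Rightarrow> 'b fun_space \<Rightarrow> bool" where
  "predual X Y \<longleftrightarrow> (\<exists>T. isomorphism_between (dual_space X) Y T)"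

definition lorentz_norm :: "(nat \<Rightarrow> real) \<Rightarrow> (nat \<Rightarrow> real) \<Rightarrow> ennreal" where
  "lorentz_norm w x = (\<Sum>j. max_rearr x (j + 1) * ennreal (w (j + 1)))"

definition lorentz_space :: "(nat \<Rightarrow> real) \<Rightarrow> nat fun_space" where
  "lorentz_space w =
     \<lparr>vecs = {x \<in> l0. lorentz_norm w x < \<infinity>}, nrm = (\<lambda>x. enn2real (lorentz_norm w x))\<rparr>"

definition fund_seq :: "(nat \<Rightarrow> real) \<Rightarrow> nat \<Rightarrow> real" where
  "fund_seq w n = nrm (lorentz_space w) (indicator {i. 1 \<le> i \<and> i \<le> n})"

definition marcinkiewicz_norm :: "(nat \<Rightarrow> real) \<Rightarrow> (nat \<Rightarrow> real) \<Rightarrow> ennreal" where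
  "marcinkiewicz_norm \<psi> y = (SUP n\<in>{1..}. max_rearr y n * ennreal (\<psi> n))"

definition marcinkiewicz_space :: "(nat \<Rightarrow> real) \<Rightarrow> nat fun_space" where
  "marcinkiewicz_space \<psi> =
     \<lparr>vecs = {y \<in> l0. marcinkiewicz_norm \<psi> y < \<infinity>},
      nrm = (\<lambda>y. enn2real (marcinkiewicz_norm \<psi> y))\<rparr>"

definition marcinkiewicz_space0 :: "(nat \<Rightarrow> real) \<Rightarrow> nat fun_space" where
  "marcinkiewicz_space0 \<psi> =
     \<lparr>vecs = {y \<in> vecs (marcinkiewicz_space \<psi>).
               (\<lambda>n. max_rearr y n * ennreal (\<psi> n)) \<longlonglongrightarrow> 0},
      nrm = nrm (marcinkiewicz_space \<psi>)\<rparr>"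

end

theory Submission
  imports Defs "HOL-Analysis.Nonnegative_Lebesgue_Integration"
begin

text \<open>
  Exchanging the order of summation turns the norm of \<open>\<gamma>\<^bsub>1,w\<^esub>\<close> into \<open>\<Sum>\<^sub>i x\<^sup>*(i) v(i)\<close>, where
  \<open>v(i) = \<Sum>\<^bsub>n\<ge>i\<^esub> w(n)/n\<close> is decreasing (\<open>lorentz_norm_eq\<close>). Hence the fundamental sequence is
  \<open>\<Phi>(n) = v(1) + \<dots> + v(n)\<close>, its limit is \<open>W(\<infinity>)\<close>, and the norm of \<open>m\<^sub>\<psi>\<close> is the supremum over \<open>n\<close> of
  \<open>(y\<^sup>*(1) + \<dots> + y\<^sup>*(n)) / \<Phi>(n)\<close>. The statement thus becomes the duality between a Lorentz and a
  Marcinkiewicz sequence space with the same decreasing weight \<open>v\<close>.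

  The sum \<open>y\<^sup>*(1) + \<dots> + y\<^sup>*(n)\<close> is the supremum of \<open>\<Sum>\<^bsub>k\<in>A\<^esub> \<bar>y(k)\<bar>\<close> over sets \<open>A\<close> of at most \<open>n\<close>
  indices (\<open>sum_rearr_le_iff\<close>). In this form the Marcinkiewicz norm is visibly
  subadditive and monotone.

  Let \<open>W(\<infinity>) = \<infinity>\<close>. A sequence \<open>x \<in> \<gamma>\<^bsub>1,w\<^esub>\<close> acts on \<open>m\<^sub>\<psi>\<^sup>0\<close> by \<open>y \<mapsto> \<Sum>\<^sub>k x(k) y(k)\<close>.
  \<^item> The norm of this functional is at most that of \<open>x\<close>: list finitely many indices in decreasing
    order of \<open>\<bar>x\<bar>\<close> and sum by parts against the bounds on sums of \<open>\<bar>y\<bar>\<close> (\<open>sum_mult_le_norms\<close>).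
  \<^item> It is at least that of \<open>x\<close>: put \<open>\<plusminus> v(1), \<dots>, \<plusminus> v(N)\<close> at indices where \<open>\<bar>x\<bar>\<close> almost attains
    \<open>x\<^sup>*(1), \<dots>, x\<^sup>*(N)\<close>. Since \<open>\<Phi>\<close> is unbounded, such a sequence lies in \<open>m\<^sub>\<psi>\<^sup>0\<close>, and its norm is
    at most 1 (\<open>lorentz_sum_coordinates_le\<close>).
  \<^item> Every functional \<open>f\<close> arises: the same test sequences bound the Lorentz norm of
    \<open>k \<mapsto> f(e\<^sub>k)\<close>, and finitely supported sequences are dense in \<open>m\<^sub>\<psi>\<^sup>0\<close> (\<open>m0_tail_small\<close>,
    \<open>dual_eqI\<close>), so that \<open>f\<close> is determined by its values on unit vectors.

  If \<open>W(\<infinity>) < \<infinity>\<close>, then \<open>\<Phi>\<close> is bounded. A member of \<open>m\<^sub>\<psi>\<^sup>0\<close> then has \<open>y\<^sup>*(1) \<le> \<epsilon> \<Phi>(n)\<close> for every \<open>\<epsilon> > 0\<close>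
  and all large \<open>n\<close>, so \<open>m\<^sub>\<psi>\<^sup>0\<close> is zero, and so is its dual; but \<open>\<gamma>\<^bsub>1,w\<^esub>\<close> is not.
\<close>

section \<open>Rearrangements and sums over small sets\<close>

text \<open>
  Equivalent to \<open>y\<^sup>*(1) + \<dots> + y\<^sup>*(n) \<le> c\<close>, but free of rearrangements, so that it behaves well under
  addition and domination. The index 0 lies outside the range of a sequence.
\<close>

definition subset_sums_le :: "(nat \<Rightarrow> real) \<Rightarrow> nat \<Rightarrow> real \<Rightarrow> bool" where
  "subset_sums_le y n c \<longleftrightarrow>
     (\<forall>A. finite A \<longrightarrow> 0 \<notin> A \<longrightarrow> card A \<le> n \<longrightarrow> (\<Sum>k\<in>A. \<bar>y k\<bar>) \<le> c)"

lemma subset_sums_leD: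
  "subset_sums_le y n c \<Longrightarrow> finite A \<Longrightarrow> 0 \<notin> A \<Longrightarrow> card A \<le> n \<Longrightarrow> (\<Sum>k\<in>A. \<bar>y k\<bar>) \<le> c"
  unfolding subset_sums_le_def by blast

lemma subset_sums_le_abs: "subset_sums_le y n c \<Longrightarrow> n \<ge> 1 \<Longrightarrow> k \<ge> 1 \<Longrightarrow> \<bar>y k\<bar> \<le> c"
  using subset_sums_leD[of y n c "{k}"] by simp

lemma subset_sums_le_mono:
  "subset_sums_le y n c \<Longrightarrow> m \<le> n \<Longrightarrow> c \<le> d \<Longrightarrow> subset_sums_le y m d"
  unfolding subset_sums_le_def by (meson order_trans)

lemma subset_sums_le_dominated:
  assumes "subset_sums_le y n c" "\<And>k. \<bar>z k\<bar> \<le> \<bar>y k\<bar>"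
  shows "subset_sums_le z n c"
  unfolding subset_sums_le_def
proof (intro allI impI)
  fix A :: "nat set" assume A: "finite A" "0 \<notin> A" "card A \<le> n"
  have "(\<Sum>k\<in>A. \<bar>z k\<bar>) \<le> (\<Sum>k\<in>A. \<bar>y k\<bar>)"
    by (rule sum_mono) (rule assms(2))
  also have "\<dots> \<le> c" by (rule subset_sums_leD[OF assms(1) A])
  finally show "(\<Sum>k\<in>A. \<bar>z k\<bar>) \<le> c" .
qed

lemma subset_sums_le_add:
  assumes "subset_sums_le y n c" "subset_sums_le z n d"
  shows "subset_sums_le (\<lambda>k. y k + z k) n (c + d)"
  unfolding subset_sums_le_def
proof (intro allI impI)
  fix A :: "nat set" assume A: "finite A" "0 \<notin> A" "card A \<le> n"
  have "(\<Sum>k\<in>A. \<bar>y k + z k\<bar>) \<le> (\<Sum>k\<in>A. \<bar>y k\<bar> + \<bar>z k\<bar>)"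
    by (rule sum_mono) (rule abs_triangle_ineq)
  also have "\<dots> \<le> c + d"
    using subset_sums_leD[OF assms(1) A] subset_sums_leD[OF assms(2) A] by (simp add: sum.distrib)
  finally show "(\<Sum>k\<in>A. \<bar>y k + z k\<bar>) \<le> c + d" .
qed

lemma subset_sums_le_scale:
  assumes "subset_sums_le y n c"
  shows "subset_sums_le (\<lambda>k. a * y k) n (\<bar>a\<bar> * c)"
  unfolding subset_sums_le_def
proof (intro allI impI)
  fix A :: "nat set" assume A: "finite A" "0 \<notin> A" "card A \<le> n"
  have "(\<Sum>k\<in>A. \<bar>a * y k\<bar>) = \<bar>a\<bar> * (\<Sum>k\<in>A. \<bar>y k\<bar>)"
    by (simp add: abs_mult sum_distrib_left)
  also have "\<dots> \<le> \<bar>a\<bar> * c"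
    using subset_sums_leD[OF assms A] by (intro mult_left_mono) auto
  finally show "(\<Sum>k\<in>A. \<bar>a * y k\<bar>) \<le> \<bar>a\<bar> * c" .
qed

text \<open>
  If \<open>n\<close> indices satisfy \<open>r \<le> \<bar>y(k)\<bar>\<close>, then no \<open>t < r\<close> has fewer than \<open>n\<close> indices above it.
\<close>

lemma le_rearrI:
  assumes "finite A" "0 \<notin> A" "n \<le> card A" "n \<ge> 1" "\<And>k. k \<in> A \<Longrightarrow> r \<le> \<bar>y k\<bar>"
  shows "ennreal r \<le> rearr y n"
  unfolding rearr_def
proof (rule Inf_greatest, clarify)
  fix t :: real assume t: "t \<ge> 0" "Defs.distr y t \<le> enat (n - 1)"
  define B where "B = {k. k \<ge> 1 \<and> \<bar>y k\<bar> > t}"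
  have B: "finite B" "card B \<le> n - 1"
    using t(2) unfolding Defs.distr_def B_def[symmetric] by (auto simp: Let_def split: if_splits)
  have "r \<le> t"
  proof (rule ccontr)
    assume "\<not> r \<le> t"
    then have "A \<subseteq> B"
      using assms(2,5) unfolding B_def by (force simp: Suc_le_eq intro: gr0I)
    then have "card A \<le> card B"
      by (rule card_mono[OF B(1)])
    with B(2) assms(3,4) show False by linarith
  qed
  then show "ennreal r \<le> ennreal t" by (rule ennreal_leI)
qed

lemma rearr_le:
  assumes "t \<ge> 0" "finite B" "card B < n" "\<And>k. k \<ge> 1 \<Longrightarrow> k \<notin> B \<Longrightarrow> \<bar>y k\<bar> \<le> t"
  shows "rearr y n \<le> ennreal t"
proof -
  have sub: "{k. k \<ge> 1 \<and> \<bar>y k\<bar> > t} \<subseteq> B"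
    using assms(4) by (auto simp: not_le[symmetric])
  have "finite {k. k \<ge> 1 \<and> \<bar>y k\<bar> > t}" "card {k. k \<ge> 1 \<and> \<bar>y k\<bar> > t} \<le> n - 1"
    using finite_subset[OF sub assms(2)] card_mono[OF assms(2) sub] assms(3) by auto
  then have "Defs.distr y t \<le> enat (n - 1)"
    by (simp add: Defs.distr_def Let_def)
  then show ?thesis
    unfolding rearr_def using assms(1) by (intro Inf_lower) auto
qed

lemma rearr_indicator:
  assumes "0 \<notin> A" "n \<ge> 1"
  shows "rearr (indicator A) n = (if finite A \<and> card A < n then 0 else 1)"
proof (cases "finite A \<and> card A < n")
  case True
  then have "rearr (indicator A) n \<le> ennreal 0"
    by (intro rearr_le[where B = A]) auto
  with True show ?thesis by simp
next
  case False
  then obtain B where B: "finite B" "B \<subseteq> A" "card B = n"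
    by (metis infinite_arbitrarily_large not_less obtain_subset_with_card_n)
  then have "ennreal 1 \<le> rearr (indicator A) n"
    using assms by (intro le_rearrI[where A = B]) (auto simp: indicator_def)
  moreover have "rearr (indicator A) n \<le> ennreal 1"
    using assms by (intro rearr_le[where B = "{}"]) (auto simp: indicator_def)
  ultimately show ?thesis using False by auto
qed

lemma decreasing_enumeration:
  fixes f :: "'a \<Rightarrow> real"
  assumes "finite A"
  shows "\<exists>a. bij_betw a {1..card A} A \<and> (\<forall>j\<in>{1..card A}. \<forall>i\<in>{1..j}. f (a j) \<le> f (a i))"
  using assms
proof (induction "card A" arbitrary: A)
  case 0
  then show ?case by (auto simp: bij_betw_def)
next
  case (Suc n)
  then have "A \<noteq> {}" by auto
  define k where "k = arg_min_on f A"
  have k: "k \<in> A" "\<And>l. l \<in> A \<Longrightarrow> f k \<le> f l"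
    using arg_min_if_finite[OF Suc.prems \<open>A \<noteq> {}\<close>, of f] unfolding k_def
    by (auto simp: not_less[symmetric])
  have card: "card (A - {k}) = n"
    using Suc k by simp
  then obtain a where a: "bij_betw a {1..n} (A - {k})"
    and dec: "\<And>j i. j \<in> {1..n} \<Longrightarrow> i \<in> {1..j} \<Longrightarrow> f (a j) \<le> f (a i)"
    using Suc.hyps(1)[of "A - {k}"] Suc.prems by (metis finite_Diff)
  define b where "b = a(Suc n := k)"
  have img: "a i \<in> A" if "i \<in> {1..n}" for i
    using a that by (auto simp: bij_betw_def)
  have "bij_betw b {1..n} (A - {k})"
    using a by (rule bij_betw_cong[THEN iffD1, rotated]) (auto simp: b_def)
  then have "bij_betw b ({1..n} \<union> {Suc n}) ((A - {k}) \<union> {k})"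
    by (rule bij_betw_combine) (auto simp: b_def bij_betw_def)
  moreover have "{1..n} \<union> {Suc n} = {1..Suc n}" by auto
  moreover have "(A - {k}) \<union> {k} = A" using k(1) by auto
  ultimately have "bij_betw b {1..Suc n} A" by simp
  moreover have "f (b j) \<le> f (b i)" if "j \<in> {1..Suc n}" "i \<in> {1..j}" for i j
  proof (cases "j = Suc n")
    case True
    then show ?thesis using that k(2)[OF img[of i]] by (cases "i = Suc n") (simp_all add: b_def)
  next
    case False
    then show ?thesis using that dec[of j i] by (simp add: b_def)
  qed
  ultimately show ?case using Suc.hyps(2) by auto
qed

lemma rearr_enumeration:
  assumes "finite A" "0 \<notin> A"
  shows "\<exists>a. bij_betw a {1..card A} A \<and>
           (\<forall>j\<in>{1..card A}. (\<forall>i\<in>{1..j}. \<bar>y (a j)\<bar> \<le> \<bar>y (a i)\<bar>) \<and> ennreal \<bar>y (a j)\<bar> \<le> rearr y j)"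
proof -
  obtain a where bij: "bij_betw a {1..card A} A"
    and dec: "\<And>j i. j \<in> {1..card A} \<Longrightarrow> i \<in> {1..j} \<Longrightarrow> \<bar>y (a j)\<bar> \<le> \<bar>y (a i)\<bar>"
    using decreasing_enumeration[OF assms(1), of "\<lambda>k. \<bar>y k\<bar>"] by blast
  have "ennreal \<bar>y (a i)\<bar> \<le> rearr y i" if i: "1 \<le> i" "i \<le> card A" for i
  proof (rule le_rearrI[where A = "a ` {1..i}"])
    have "inj_on a {1..i}"
      using bij i by (auto simp: bij_betw_def intro: inj_on_subset)
    then show "i \<le> card (a ` {1..i})" by (simp add: card_image)
    have "a ` {1..i} \<subseteq> A" using bij i by (auto simp: bij_betw_def)
    then show "0 \<notin> a ` {1..i}" using assms(2) by blast
  qed (use i dec in auto)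
  then show ?thesis using bij dec by (intro exI[of _ a]) auto
qed

text \<open>
  The values \<open>y\<^sup>*(i)\<close> need not be attained by \<open>\<bar>y\<bar>\<close> when \<open>y\<close> does not tend to 0; allowing an error
  \<open>\<epsilon>\<close> makes it possible to treat all bounded sequences alike. The indices are chosen greedily:
  discarding fewer than \<open>i\<close> indices always leaves one at which \<open>\<bar>y\<bar>\<close> exceeds \<open>y\<^sup>*(i) - \<epsilon>\<close>.
\<close>

lemma near_optimal_enumeration:
  assumes bounded: "\<And>k. k \<ge> 1 \<Longrightarrow> \<bar>y k\<bar> \<le> M" and "\<epsilon> > 0"
  shows "\<exists>a. inj_on a {1..N} \<and> 0 \<notin> a ` {1..N} \<and>
           (\<forall>i\<in>{1..N}. rearr y i \<le> ennreal (\<bar>y (a i)\<bar> + \<epsilon>))"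
proof (induction N)
  case 0
  then show ?case by simp
next
  case (Suc N)
  then obtain a where a: "inj_on a {1..N}" "0 \<notin> a ` {1..N}"
    "\<And>i. i \<in> {1..N} \<Longrightarrow> rearr y i \<le> ennreal (\<bar>y (a i)\<bar> + \<epsilon>)" by blast
  define B where "B = a ` {1..N}"
  have B: "finite B" "card B < Suc N"
    using card_image_le[of "{1..N}" a] by (auto simp: B_def)
  have "\<exists>k\<ge>1. k \<notin> B \<and> rearr y (Suc N) \<le> ennreal (\<bar>y k\<bar> + \<epsilon>)"
  proof (rule ccontr)
    assume none: "\<not> ?thesis"
    have far: "ennreal (\<bar>y k\<bar> + \<epsilon>) < rearr y (Suc N)" if "k \<ge> 1" "k \<notin> B" for k
      using that none by (metis not_le)
    have "rearr y (Suc N) \<le> ennreal \<bar>M\<bar>"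
      using bounded by (intro rearr_le[where B = "{}"]) (auto intro: order_trans[OF _ abs_ge_self])
    then obtain s where s: "s \<ge> 0" "rearr y (Suc N) = ennreal s"
      by (metis ennreal_cases ennreal_neq_top neq_top_trans)
    have far': "\<bar>y k\<bar> + \<epsilon> < s" if "k \<ge> 1" "k \<notin> B" for k
      using far[OF that] s(1) unfolding s(2) by (subst (asm) ennreal_less_iff) (use \<open>\<epsilon> > 0\<close> in auto)
    \<comment> \<open>Such an index shows that \<open>s - \<epsilon>\<close> is nonnegative, as a threshold has to be.\<close>
    obtain k where k: "k \<ge> 1" "k \<notin> B"
      using infinite_imp_nonempty[OF Diff_infinite_finite[OF B(1) infinite_Ici[of "1::nat"]]] by auto
    have "rearr y (Suc N) \<le> ennreal (s - \<epsilon>)"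
      using far' far'[OF k] B by (intro rearr_le[where B = B]) (auto intro: less_imp_le simp: algebra_simps)
    then show False using s far'[OF k] \<open>\<epsilon> > 0\<close> by (simp add: ennreal_le_iff2)
  qed
  then obtain k where k: "k \<ge> 1" "k \<notin> B" "rearr y (Suc N) \<le> ennreal (\<bar>y k\<bar> + \<epsilon>)" by blast
  have eq: "{1..Suc N} = insert (Suc N) {1..N}" by auto
  show ?case
  proof (intro exI[of _ "a(Suc N := k)"] conjI ballI)
    show "inj_on (a(Suc N := k)) {1..Suc N}"
      unfolding eq inj_on_insert
      using inj_on_fun_updI[OF a(1) k(2)[unfolded B_def], of "Suc N"] k(2) by (simp add: B_def)
    show "0 \<notin> (a(Suc N := k)) ` {1..Suc N}"
      using a(2) k(1) by (auto simp: image_iff le_Suc_eq)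
    show "rearr y i \<le> ennreal (\<bar>y ((a(Suc N := k)) i)\<bar> + \<epsilon>)" if "i \<in> {1..Suc N}" for i
      using that a(3)[of i] k(3) by (cases "i = Suc N") simp_all
  qed
qed

text \<open>
  The indices of a near-optimal enumeration realise \<open>y\<^sup>*(1) + \<dots> + y\<^sup>*(n)\<close> up to an arbitrarily small
  error, and no set of at most \<open>n\<close> indices exceeds this sum, because its \<open>i\<close>-th largest value is at
  most \<open>y\<^sup>*(i)\<close>.
\<close>

lemma sum_rearr_le_iff:
  assumes "c \<ge> 0"
  shows "(\<Sum>i=1..n. rearr y i) \<le> ennreal c \<longleftrightarrow> subset_sums_le y n c"
proof
  assume le: "(\<Sum>i=1..n. rearr y i) \<le> ennreal c"
  show "subset_sums_le y n c"
    unfolding subset_sums_le_def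
  proof (intro allI impI)
    fix A :: "nat set" assume A: "finite A" "0 \<notin> A" "card A \<le> n"
    obtain a where a: "bij_betw a {1..card A} A"
      and le_rearr: "\<And>i. i \<in> {1..card A} \<Longrightarrow> ennreal \<bar>y (a i)\<bar> \<le> rearr y i"
      using rearr_enumeration[OF A(1,2), of y] by blast
    have "ennreal (\<Sum>k\<in>A. \<bar>y k\<bar>) = (\<Sum>i=1..card A. ennreal \<bar>y (a i)\<bar>)"
      by (simp add: sum.reindex_bij_betw[OF a, of "\<lambda>k. \<bar>y k\<bar>", symmetric])
    also have "\<dots> \<le> (\<Sum>i=1..card A. rearr y i)"
      by (intro sum_mono le_rearr)
    also have "\<dots> \<le> (\<Sum>i=1..n. rearr y i)"
      using A(3) by (intro sum_mono2) auto
    also note le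
    finally show "(\<Sum>k\<in>A. \<bar>y k\<bar>) \<le> c" using assms by simp
  qed
next
  assume sums: "subset_sums_le y n c"
  show "(\<Sum>i=1..n. rearr y i) \<le> ennreal c"
  proof (cases "n = 0")
    case False
    then have bounded: "\<bar>y k\<bar> \<le> c" if "k \<ge> 1" for k
      using subset_sums_le_abs[OF sums _ that] by simp
    show ?thesis
    proof (rule ennreal_le_epsilon)
      fix e :: real assume "e > 0"
      define \<epsilon> where "\<epsilon> = e / n"
      have "\<epsilon> > 0" using False \<open>e > 0\<close> by (simp add: \<epsilon>_def)
      obtain a where "inj_on a {1..n} \<and> 0 \<notin> a ` {1..n} \<and>
          (\<forall>i\<in>{1..n}. rearr y i \<le> ennreal (\<bar>y (a i)\<bar> + \<epsilon>))"
        using near_optimal_enumeration[where N = n and y = y, OF bounded \<open>\<epsilon> > 0\<close>] ..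
      then have a: "inj_on a {1..n}" "0 \<notin> a ` {1..n}"
        and near: "\<And>i. i \<in> {1..n} \<Longrightarrow> rearr y i \<le> ennreal (\<bar>y (a i)\<bar> + \<epsilon>)"
        by simp_all
      have "(\<Sum>i=1..n. \<bar>y (a i)\<bar>) = (\<Sum>k\<in>a ` {1..n}. \<bar>y k\<bar>)"
        by (subst sum.reindex[OF a(1)]) (simp add: o_def)
      also have "\<dots> \<le> c"
        using a(2) card_image_le[of "{1..n}" a] by (intro subset_sums_leD[OF sums]) auto
      finally have *: "(\<Sum>i=1..n. \<bar>y (a i)\<bar> + \<epsilon>) \<le> c + e"
        using False by (simp add: sum.distrib \<epsilon>_def)
      have "(\<Sum>i=1..n. rearr y i) \<le> (\<Sum>i=1..n. ennreal (\<bar>y (a i)\<bar> + \<epsilon>))"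
        by (intro sum_mono near)
      also have "\<dots> = ennreal (\<Sum>i=1..n. \<bar>y (a i)\<bar> + \<epsilon>)"
        using \<open>\<epsilon> > 0\<close> by (intro sum_ennreal) auto
      also have "\<dots> \<le> ennreal (c + e)" using * by (rule ennreal_leI)
      also have "\<dots> = ennreal c + ennreal e" using assms \<open>e > 0\<close> by simp
      finally show "(\<Sum>i=1..n. rearr y i) \<le> ennreal c + ennreal e" .
    qed
  qed simp
qed


section \<open>Marcinkiewicz spaces of a decreasing weight\<close>

text \<open>
  Summation by parts: a decreasing nonnegative \<open>g\<close> is a nonnegative combination of indicators of
  initial segments, on which the hypothesis compares \<open>b\<close> with \<open>c\<close>.
\<close>

lemma sum_mult_le_of_partial_sums_le:
  fixes g b c :: "nat \<Rightarrow> real"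
  assumes "\<And>i. i \<in> {1..N} \<Longrightarrow> 0 \<le> g i"
    and dec: "\<And>i. 1 \<le> i \<Longrightarrow> Suc i \<le> N \<Longrightarrow> g (Suc i) \<le> g i"
    and le: "\<And>n. n \<in> {1..N} \<Longrightarrow> (\<Sum>i=1..n. b i) \<le> (\<Sum>i=1..n. c i)"
  shows "(\<Sum>i=1..N. g i * b i) \<le> (\<Sum>i=1..N. g i * c i)"
proof -
  define d where "d n = (\<Sum>i=1..n. c i) - (\<Sum>i=1..n. b i)" for n
  \<comment> \<open>The term \<open>g n * d n\<close> is the boundary term of the summation by parts; keeping it makes the induction work.\<close>
  have "g n * d n \<le> (\<Sum>i=1..n. g i * c i) - (\<Sum>i=1..n. g i * b i)" if "n \<le> N" for n
    using that
  proof (induction n)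
    case 0
    then show ?case by (simp add: d_def)
  next
    case (Suc n)
    have "g (Suc n) * d n \<le> g n * d n"
    proof (cases "n = 0")
      case False
      then show ?thesis
        using Suc.prems dec[of n] le[of n] by (intro mult_right_mono) (auto simp: d_def)
    qed (simp add: d_def)
    with Suc show ?case by (simp add: d_def algebra_simps)
  qed
  moreover have "0 \<le> g N * d N"
    using assms(1)[of N] le[of N] by (cases "N = 0") (simp_all add: d_def)
  ultimately show ?thesis by (meson diff_ge_0_iff_ge order_refl order_trans)
qed

locale decreasing_weight =
  fixes v \<psi> :: "nat \<Rightarrow> real"
  assumes v_nonneg: "\<And>i. 1 \<le> i \<Longrightarrow> 0 \<le> v i"
    and v_antimono: "\<And>i j. 1 \<le> i \<Longrightarrow> i \<le> j \<Longrightarrow> v j \<le> v i"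
    and v_1_pos: "0 < v 1"
    and psi_eq: "\<And>n. 1 \<le> n \<Longrightarrow> \<psi> n = real n / (\<Sum>i=1..n. v i)"
begin

definition Phi :: "nat \<Rightarrow> real" where
  "Phi n = (\<Sum>i=1..n. v i)"

abbreviation m0 :: "nat fun_space" where
  "m0 \<equiv> marcinkiewicz_space0 \<psi>"

lemma Phi_mono: "m \<le> n \<Longrightarrow> Phi m \<le> Phi n"
  unfolding Phi_def by (rule sum_mono2) (auto intro: v_nonneg)

lemma Phi_pos: "n \<ge> 1 \<Longrightarrow> 0 < Phi n"
  using Phi_mono[of 1 n] v_1_pos by (simp add: Phi_def)

lemma Phi_nonneg: "0 \<le> Phi n"
  using Phi_mono[of 0 n] by (simp add: Phi_def)

lemma Phi_le: "Phi n \<le> real n * v 1"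
  using sum_bounded_above[of "{1..n}" v "v 1"] v_antimono[of 1] by (simp add: Phi_def)

text \<open>
  The largest element of a set of \<open>n + 1\<close> positive indices is at least \<open>n + 1\<close>, so removing it costs
  at most \<open>v(n + 1)\<close>.
\<close>

lemma sum_le_Phi:
  "finite I \<Longrightarrow> 0 \<notin> I \<Longrightarrow> card I \<le> n \<Longrightarrow> sum v I \<le> Phi n"
proof (induction n arbitrary: I)
  case 0
  then show ?case by (simp add: Phi_def)
next
  case (Suc n)
  show ?case
  proof (cases "card I \<le> n")
    case True
    then show ?thesis using Suc.IH[of I] Suc.prems Phi_mono[of n "Suc n"] by simp
  next
    case False
    then have card: "card I = Suc n" using Suc.prems by simp
    then have "I \<noteq> {}" by auto
    define m where "m = Max I"
    have m: "m \<in> I" using Suc.prems \<open>I \<noteq> {}\<close> by (simp add: m_def)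
    have "I \<subseteq> {1..m}"
    proof
      fix i assume "i \<in> I"
      with Suc.prems show "i \<in> {1..m}" by (cases i) (auto simp: m_def)
    qed
    then have "Suc n \<le> m" using card card_mono[of "{1..m}" I] by simp
    then have "v m \<le> v (Suc n)" by (intro v_antimono) auto
    moreover have "sum v (I - {m}) \<le> Phi n"
      using Suc.IH[of "I - {m}"] Suc.prems m card by simp
    moreover have "sum v I = v m + sum v (I - {m})"
      using sum.remove[OF Suc.prems(1) m] .
    moreover have "Phi (Suc n) = Phi n + v (Suc n)" by (simp add: Phi_def)
    ultimately show ?thesis by linarith
  qed
qed

text \<open>
  In \<open>y\<^sup>*\<^sup>*(n) \<psi>(n)\<close> the factors \<open>1/n\<close> and \<open>n\<close> cancel, leaving \<open>(y\<^sup>*(1) + \<dots> + y\<^sup>*(n)) / \<Phi>(n)\<close>.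
\<close>

lemma max_rearr_psi_le_iff:
  assumes "n \<ge> 1" "C \<ge> 0"
  shows "max_rearr y n * ennreal (\<psi> n) \<le> ennreal C \<longleftrightarrow> subset_sums_le y n (C * Phi n)"
proof -
  have pos: "0 < Phi n" "0 < \<psi> n" using Phi_pos[OF assms(1)] assms(1) psi_eq[OF assms(1)]
    by (auto simp: Phi_def)
  have "max_rearr y n * ennreal (\<psi> n) \<le> ennreal C \<longleftrightarrow>
          (\<Sum>i=1..n. rearr y i) \<le> ennreal (C * Phi n)"
  proof (cases "\<Sum>i=1..n. rearr y i")
    case (real r)
    have "max_rearr y n * ennreal (\<psi> n) = ennreal (r / n * \<psi> n)"
      unfolding max_rearr_def real(2) using assms(1) real(1) pos(2)
      by (simp add: ennreal_of_nat_eq_real_of_nat divide_ennreal ennreal_mult[symmetric])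
    also have "r / n * \<psi> n = r / Phi n"
      using assms(1) by (simp add: psi_eq Phi_def)
    finally show ?thesis
      using real assms pos by (simp add: ennreal_le_iff pos_divide_le_eq)
  next
    case top
    have "max_rearr y n * ennreal (\<psi> n) = top"
      unfolding max_rearr_def top using pos
      by (simp add: ennreal_top_divide ennreal_top_mult ennreal_of_nat_eq_real_of_nat)
    moreover have "\<not> (top :: ennreal) \<le> ennreal c" for c by (simp add: top_unique)
    ultimately show ?thesis unfolding top by (simp only:)
  qed
  also have "\<dots> \<longleftrightarrow> subset_sums_le y n (C * Phi n)"
    using assms pos by (intro sum_rearr_le_iff) auto
  finally show ?thesis .
qed

lemma marcinkiewicz_norm_le_iff:
  assumes "C \<ge> 0"
  shows "marcinkiewicz_norm \<psi> y \<le> ennreal C \<longleftrightarrow> (\<forall>n\<ge>1. subset_sums_le y n (C * Phi n))"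
  unfolding marcinkiewicz_norm_def SUP_le_iff using max_rearr_psi_le_iff[OF _ assms] by auto

text \<open>
  The limit condition alone already forces the norm to be finite: the finitely many sums over
  fewer than \<open>M\<close> indices are bounded by the one over \<open>M\<close> indices, while \<open>\<Phi> \<ge> v(1) > 0\<close>.
\<close>

lemma m0_iff:
  "y \<in> vecs m0 \<longleftrightarrow>
     y 0 = 0 \<and> (\<forall>\<epsilon>>0. eventually (\<lambda>n. subset_sums_le y n (\<epsilon> * Phi n)) sequentially)"
    (is "_ \<longleftrightarrow> _ \<and> ?small")
proof
  assume y: "y \<in> vecs m0"
  have "eventually (\<lambda>n. subset_sums_le y n (\<epsilon> * Phi n)) sequentially" if "\<epsilon> > 0" for \<epsilon>
  proof -
    have "(\<lambda>n. max_rearr y n * ennreal (\<psi> n)) \<longlonglongrightarrow> 0"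
      using y by (simp add: marcinkiewicz_space0_def)
    then have "eventually (\<lambda>n. max_rearr y n * ennreal (\<psi> n) < ennreal \<epsilon>) sequentially"
      using that by (intro order_tendstoD(2)) auto
    then show ?thesis
      using eventually_ge_at_top[of 1]
    proof eventually_elim
      case (elim n)
      then show ?case using max_rearr_psi_le_iff[of n \<epsilon> y] that by (auto intro: less_imp_le)
    qed
  qed
  then show "y 0 = 0 \<and> ?small"
    using y by (simp add: marcinkiewicz_space0_def marcinkiewicz_space_def l0_def)
next
  assume y: "y 0 = 0 \<and> ?small"
  have "(\<lambda>n. max_rearr y n * ennreal (\<psi> n)) \<longlonglongrightarrow> 0"
  proof (rule order_tendstoI)
    fix e :: ennreal assume "0 < e"
    then obtain d where d: "0 < d" "d < e" using dense by blast
    then obtain \<epsilon> where \<epsilon>: "\<epsilon> \<ge> 0" "d = ennreal \<epsilon>" by (metis ennreal_cases less_top_ennreal order_less_le_trans top_greatest)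
    with d have "\<epsilon> > 0" by simp
    then have "eventually (\<lambda>n. subset_sums_le y n (\<epsilon> * Phi n)) sequentially" using y by blast
    then show "eventually (\<lambda>n. max_rearr y n * ennreal (\<psi> n) < e) sequentially"
      using eventually_ge_at_top[of 1]
    proof eventually_elim
      case (elim n)
      then have "max_rearr y n * ennreal (\<psi> n) \<le> d"
        using max_rearr_psi_le_iff[of n \<epsilon> y] \<epsilon> by simp
      with d(2) show ?case by simp
    qed
  qed simp
  moreover have "marcinkiewicz_norm \<psi> y < \<infinity>"
  proof -
    have "eventually (\<lambda>n. subset_sums_le y n (1 * Phi n)) sequentially"
      using y zero_less_one by blast
    then obtain M' where M': "\<And>n. n \<ge> M' \<Longrightarrow> subset_sums_le y n (Phi n)"
      by (auto simp: eventually_sequentially)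
    define M where "M = max M' 1"
    have M: "M \<ge> 1" "\<And>n. n \<ge> M \<Longrightarrow> subset_sums_le y n (Phi n)" using M' by (auto simp: M_def)
    define C where "C = Phi M / Phi 1"
    have "1 \<le> C" using Phi_mono[OF M(1)] Phi_pos[of 1] by (simp add: C_def)
    have "subset_sums_le y n (C * Phi n)" if "n \<ge> 1" for n
    proof (cases "n \<ge> M")
      case True
      then show ?thesis
        using mult_right_mono[OF \<open>1 \<le> C\<close> Phi_nonneg[of n]] by (intro subset_sums_le_mono[OF M(2)]) auto
    next
      case False
      have "Phi M = C * Phi 1" using Phi_pos[of 1] by (simp add: C_def)
      also have "\<dots> \<le> C * Phi n" using Phi_mono[OF that] \<open>1 \<le> C\<close> by (intro mult_left_mono) auto
      finally show ?thesis using False by (intro subset_sums_le_mono[OF M(2)[of M]]) auto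
    qed
    then have "marcinkiewicz_norm \<psi> y \<le> ennreal C"
      using \<open>1 \<le> C\<close> by (subst marcinkiewicz_norm_le_iff) auto
    then show ?thesis by (rule le_less_trans) simp
  qed
  ultimately show "y \<in> vecs m0"
    using y by (simp add: marcinkiewicz_space0_def marcinkiewicz_space_def l0_def)
qed

lemma m0_small:
  assumes "y \<in> vecs m0" "\<epsilon> > 0"
  shows "\<exists>M\<ge>1. \<forall>n\<ge>M. subset_sums_le y n (\<epsilon> * Phi n)"
proof -
  have "eventually (\<lambda>n. subset_sums_le y n (\<epsilon> * Phi n)) sequentially"
    using assms unfolding m0_iff by blast
  then obtain M where "\<And>n. n \<ge> M \<Longrightarrow> subset_sums_le y n (\<epsilon> * Phi n)"
    by (auto simp: eventually_sequentially)
  then show ?thesis by (intro exI[of _ "max M 1"]) simp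
qed

lemma subset_sums_le_m0_norm:
  assumes "y \<in> vecs m0" "n \<ge> 1"
  shows "subset_sums_le y n (nrm m0 y * Phi n)"
proof -
  have "marcinkiewicz_norm \<psi> y < top"
    using assms(1) by (simp add: marcinkiewicz_space0_def marcinkiewicz_space_def)
  then have "marcinkiewicz_norm \<psi> y \<le> ennreal (nrm m0 y)"
    by (simp add: marcinkiewicz_space0_def marcinkiewicz_space_def)
  then show ?thesis
    using assms(2) marcinkiewicz_norm_le_iff[of "nrm m0 y" y]
    by (simp add: marcinkiewicz_space0_def marcinkiewicz_space_def)
qed

lemma m0_norm_nonneg: "0 \<le> nrm m0 y"
  by (simp add: marcinkiewicz_space0_def marcinkiewicz_space_def)

lemma m0_norm_leI:
  assumes "C \<ge> 0" "\<And>n. n \<ge> 1 \<Longrightarrow> subset_sums_le y n (C * Phi n)"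
  shows "nrm m0 y \<le> C"
  using assms marcinkiewicz_norm_le_iff[OF assms(1), of y]
  by (simp add: marcinkiewicz_space0_def marcinkiewicz_space_def enn2real_leI)

lemma m0_add:
  assumes "y \<in> vecs m0" "z \<in> vecs m0"
  shows "(\<lambda>k. y k + z k) \<in> vecs m0"
  unfolding m0_iff
proof (intro conjI allI impI)
  fix \<epsilon> :: real assume "\<epsilon> > 0"
  then have "\<epsilon> / 2 > 0" by simp
  with assms have "eventually (\<lambda>n. subset_sums_le y n (\<epsilon> / 2 * Phi n)) sequentially"
    "eventually (\<lambda>n. subset_sums_le z n (\<epsilon> / 2 * Phi n)) sequentially"
    unfolding m0_iff by blast+
  then show "eventually (\<lambda>n. subset_sums_le (\<lambda>k. y k + z k) n (\<epsilon> * Phi n)) sequentially"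
  proof eventually_elim
    case (elim n)
    from subset_sums_le_add[OF this] show ?case by simp
  qed
qed (use assms in \<open>simp add: m0_iff\<close>)

lemma m0_scale:
  assumes "y \<in> vecs m0"
  shows "(\<lambda>k. c * y k) \<in> vecs m0"
  unfolding m0_iff
proof (intro conjI allI impI)
  fix \<epsilon> :: real assume \<epsilon>: "\<epsilon> > 0"
  then have "\<epsilon> / (\<bar>c\<bar> + 1) > 0" by simp
  with assms have "eventually (\<lambda>n. subset_sums_le y n (\<epsilon> / (\<bar>c\<bar> + 1) * Phi n)) sequentially"
    unfolding m0_iff by blast
  then show "eventually (\<lambda>n. subset_sums_le (\<lambda>k. c * y k) n (\<epsilon> * Phi n)) sequentially"
  proof eventually_elim
    case (elim n)
    have "\<bar>c\<bar> * (\<epsilon> / (\<bar>c\<bar> + 1)) \<le> \<epsilon>" using \<epsilon> by (simp add: field_simps)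
    from mult_right_mono[OF this Phi_nonneg[of n]] show ?case
      by (intro subset_sums_le_mono[OF subset_sums_le_scale[OF elim, of c]]) (auto simp: mult.assoc)
  qed
qed (use assms in \<open>simp add: m0_iff\<close>)

lemma m0_dominated:
  assumes "y \<in> vecs m0" "\<And>k. \<bar>z k\<bar> \<le> \<bar>y k\<bar>"
  shows "z \<in> vecs m0"
  unfolding m0_iff
proof (intro conjI allI impI)
  show "z 0 = 0" using assms(1) assms(2)[of 0] by (simp add: m0_iff)
next
  fix \<epsilon> :: real assume "\<epsilon> > 0"
  with assms(1) have "eventually (\<lambda>n. subset_sums_le y n (\<epsilon> * Phi n)) sequentially"
    unfolding m0_iff by blast
  then show "eventually (\<lambda>n. subset_sums_le z n (\<epsilon> * Phi n)) sequentially"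
    by eventually_elim (rule subset_sums_le_dominated[OF _ assms(2)])
qed

lemma m0_trivial_if_bounded:
  assumes bounded: "\<And>n. Phi n \<le> B" and y: "y \<in> vecs m0"
  shows "y = (\<lambda>_. 0)"
proof
  fix k
  show "y k = 0"
  proof (cases "k = 0")
    case False
    have "0 < B" using bounded[of 1] Phi_pos[of 1] by simp
    have "\<bar>y k\<bar> \<le> 0 + e" if "e > 0" for e
    proof -
      have "e / B > 0" using that \<open>0 < B\<close> by simp
      from m0_small[OF y this] obtain n where n: "n \<ge> 1" "subset_sums_le y n (e / B * Phi n)"
        by blast
      have "\<bar>y k\<bar> \<le> e / B * Phi n" using False by (intro subset_sums_le_abs[OF n(2,1)]) auto
      also have "\<dots> \<le> e / B * B" using bounded \<open>e / B > 0\<close> by (intro mult_left_mono) auto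
      finally show ?thesis using \<open>0 < B\<close> by simp
    qed
    then have "\<bar>y k\<bar> \<le> 0" by (rule field_le_epsilon)
    then show ?thesis by simp
  qed (use y in \<open>simp add: m0_iff\<close>)
qed

text \<open>
  Sequences in \<open>m\<^sub>\<psi>\<^sup>0\<close> tend to 0: \<open>n\<close> values above \<open>\<delta>\<close> have sum at least \<open>n \<delta>\<close>, but
  \<open>\<epsilon> \<Phi>(n) \<le> \<epsilon> n v(1)\<close> is smaller as soon as \<open>\<epsilon> < \<delta> / v(1)\<close>.
\<close>

lemma finite_level_set_m0:
  assumes "y \<in> vecs m0" "\<delta> > 0"
  shows "finite {k. \<bar>y k\<bar> > \<delta>}"
proof (rule ccontr)
  assume inf: "infinite {k. \<bar>y k\<bar> > \<delta>}"
  define \<epsilon> where "\<epsilon> = \<delta> / (2 * v 1)"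
  have "\<epsilon> > 0" using assms(2) v_1_pos by (simp add: \<epsilon>_def)
  from m0_small[OF assms(1) this] obtain n where n: "n \<ge> 1" "subset_sums_le y n (\<epsilon> * Phi n)"
    by blast
  obtain A where A: "A \<subseteq> {k. \<bar>y k\<bar> > \<delta>}" "card A = n" "finite A"
    using infinite_arbitrarily_large[OF inf] by blast
  have "0 \<notin> A" using A(1) assms by (auto simp: m0_iff)
  have "real n * \<delta> \<le> (\<Sum>k\<in>A. \<bar>y k\<bar>)"
    using sum_bounded_below[of A \<delta> "\<lambda>k. \<bar>y k\<bar>"] A by (auto intro: less_imp_le)
  also have "\<dots> \<le> \<epsilon> * Phi n" using A \<open>0 \<notin> A\<close> by (intro subset_sums_leD[OF n(2)]) auto
  also have "\<dots> \<le> \<epsilon> * (real n * v 1)" using Phi_le[of n] \<open>\<epsilon> > 0\<close> by (intro mult_left_mono) auto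
  also have "\<dots> = real n * \<delta> / 2" using v_1_pos by (simp add: \<epsilon>_def)
  finally show False using n(1) assms(2) by simp
qed

text \<open>
  Density of the finitely supported sequences. For sums over \<open>n \<ge> M\<close> indices the tail inherits
  the smallness of \<open>y\<close>. For the others it is enough that all entries of the tail are at most
  \<open>\<epsilon> v(1) / M\<close>, which holds beyond some index because \<open>y\<close> tends to 0.
\<close>

lemma m0_tail_small:
  assumes "y \<in> vecs m0" "\<epsilon> > 0"
  shows "\<exists>N. nrm m0 (\<lambda>k. if k \<le> N then 0 else y k) \<le> \<epsilon>"
proof -
  obtain M where M: "M \<ge> 1" "\<And>n. n \<ge> M \<Longrightarrow> subset_sums_le y n (\<epsilon> * Phi n)"
    using m0_small[OF assms] by blast
  define \<delta> where "\<delta> = \<epsilon> * Phi 1 / M"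
  have "\<delta> > 0" using assms(2) M(1) Phi_pos[of 1] by (simp add: \<delta>_def)
  then obtain N where N: "\<And>k. \<bar>y k\<bar> > \<delta> \<Longrightarrow> k \<le> N"
    using finite_level_set_m0[OF assms(1)] by (metis finite_nat_set_iff_bounded_le mem_Collect_eq)
  define z where "z = (\<lambda>k. if k \<le> N then 0 else y k)"
  have z_le: "\<bar>z k\<bar> \<le> \<delta>" for k using N[of k] \<open>\<delta> > 0\<close> by (auto simp: z_def not_le[symmetric])
  have "nrm m0 z \<le> \<epsilon>"
  proof (rule m0_norm_leI)
    fix n :: nat assume "n \<ge> 1"
    show "subset_sums_le z n (\<epsilon> * Phi n)"
    proof (cases "n \<ge> M")
      case True
      then show ?thesis by (intro subset_sums_le_dominated[OF M(2)]) (auto simp: z_def)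
    next
      case False
      show ?thesis
        unfolding subset_sums_le_def
      proof (intro allI impI)
        fix A :: "nat set" assume A: "finite A" "0 \<notin> A" "card A \<le> n"
        have "(\<Sum>k\<in>A. \<bar>z k\<bar>) \<le> real (card A) * \<delta>" using z_le by (rule sum_bounded_above)
        also have "\<dots> \<le> real M * \<delta>" using A(3) False \<open>\<delta> > 0\<close> by (intro mult_right_mono) auto
        also have "\<dots> = \<epsilon> * Phi 1" using M(1) by (simp add: \<delta>_def)
        also have "\<dots> \<le> \<epsilon> * Phi n" using Phi_mono[OF \<open>n \<ge> 1\<close>] assms(2) by simp
        finally show "(\<Sum>k\<in>A. \<bar>z k\<bar>) \<le> \<epsilon> * Phi n" .
      qed
    qed
  qed (use assms(2) in simp)
  then show ?thesis unfolding z_def by blast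
qed


section \<open>Duality\<close>

lemma linear_functional_on_add:
  "linear_functional_on V f \<Longrightarrow> x \<in> V \<Longrightarrow> y \<in> V \<Longrightarrow> f (\<lambda>k. x k + y k) = f x + f y"
  by (simp add: linear_functional_on_def)

definition lorentz_sum :: "(nat \<Rightarrow> real) \<Rightarrow> ennreal" where
  "lorentz_sum x = (\<Sum>j. rearr x (Suc j) * ennreal (v (Suc j)))"

definition lorentz_space_v :: "nat fun_space" where
  "lorentz_space_v = \<lparr>vecs = {x \<in> l0. lorentz_sum x < \<infinity>}, nrm = (\<lambda>x. enn2real (lorentz_sum x))\<rparr>"

text \<open>
  The Hoelder inequality of the pairing. When the indices are listed in decreasing order of \<open>\<bar>x\<bar>\<close>,
  the first \<open>n\<close> values of \<open>\<bar>y\<bar>\<close> have sum at most \<open>\<parallel>y\<parallel> \<Phi>(n)\<close>, so summation by parts replaces \<open>\<bar>y\<bar>\<close> by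
  \<open>\<parallel>y\<parallel> v\<close>; the values of \<open>\<bar>x\<bar>\<close> in this order are dominated by \<open>x\<^sup>*\<close>.
\<close>

lemma sum_mult_le_norms:
  assumes x: "lorentz_sum x < \<infinity>" and y: "y \<in> vecs m0" and F: "finite F" "0 \<notin> F"
  shows "(\<Sum>k\<in>F. \<bar>x k * y k\<bar>) \<le> enn2real (lorentz_sum x) * nrm m0 y"
proof -
  define N where "N = card F"
  obtain a where a: "bij_betw a {1..N} F"
    and dec: "\<And>i j. j \<in> {1..N} \<Longrightarrow> i \<in> {1..j} \<Longrightarrow> \<bar>x (a j)\<bar> \<le> \<bar>x (a i)\<bar>"
    and le_rearr: "\<And>i. i \<in> {1..N} \<Longrightarrow> ennreal \<bar>x (a i)\<bar> \<le> rearr x i"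
    using rearr_enumeration[OF F, of x] unfolding N_def by blast
  have "(\<Sum>k\<in>F. \<bar>x k * y k\<bar>) = (\<Sum>i=1..N. \<bar>x (a i)\<bar> * \<bar>y (a i)\<bar>)"
    unfolding abs_mult by (rule sum.reindex_bij_betw[OF a, symmetric])
  also have "\<dots> \<le> (\<Sum>i=1..N. \<bar>x (a i)\<bar> * (nrm m0 y * v i))"
  proof (rule sum_mult_le_of_partial_sums_le)
    fix n assume n: "n \<in> {1..N}"
    have inj: "inj_on a {1..n}" using a n by (auto simp: bij_betw_def intro: inj_on_subset)
    have "a ` {1..n} \<subseteq> F" using a n by (auto simp: bij_betw_def)
    have "(\<Sum>i=1..n. \<bar>y (a i)\<bar>) = (\<Sum>k\<in>a ` {1..n}. \<bar>y k\<bar>)"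
      by (subst sum.reindex[OF inj]) (simp add: o_def)
    also have "\<dots> \<le> nrm m0 y * Phi n"
    proof (rule subset_sums_leD[OF subset_sums_le_m0_norm[OF y]])
      show "0 \<notin> a ` {1..n}" using \<open>a ` {1..n} \<subseteq> F\<close> F(2) by blast
      show "card (a ` {1..n}) \<le> n" using card_image_le[of "{1..n}" a] by simp
    qed (use n in auto)
    also have "\<dots> = (\<Sum>i=1..n. nrm m0 y * v i)" by (simp add: Phi_def sum_distrib_left)
    finally show "(\<Sum>i=1..n. \<bar>y (a i)\<bar>) \<le> (\<Sum>i=1..n. nrm m0 y * v i)" .
  qed (use dec in auto)
  also have "\<dots> = (\<Sum>i=1..N. \<bar>x (a i)\<bar> * v i) * nrm m0 y"
    unfolding sum_distrib_right by (intro sum.cong refl) (simp only: mult_ac)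
  also have "\<dots> \<le> enn2real (lorentz_sum x) * nrm m0 y"
  proof (rule mult_right_mono[OF _ m0_norm_nonneg])
    have "ennreal (\<Sum>i=1..N. \<bar>x (a i)\<bar> * v i) = (\<Sum>i=1..N. ennreal \<bar>x (a i)\<bar> * ennreal (v i))"
      using v_nonneg by (subst sum_ennreal[symmetric]) (auto simp: ennreal_mult)
    also have "\<dots> \<le> (\<Sum>i=1..N. rearr x i * ennreal (v i))"
      by (intro sum_mono mult_right_mono le_rearr) auto
    also have "\<dots> = (\<Sum>j<N. rearr x (Suc j) * ennreal (v (Suc j)))"
      using sum.atLeast1_atMost_eq[of "\<lambda>i. rearr x i * ennreal (v i)" N] by simp
    also have "\<dots> \<le> lorentz_sum x"
      unfolding lorentz_sum_def by (rule sum_le_suminf) auto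
    also have "\<dots> = ennreal (enn2real (lorentz_sum x))" using x by simp
    finally show "(\<Sum>i=1..N. \<bar>x (a i)\<bar> * v i) \<le> enn2real (lorentz_sum x)"
      by (simp add: ennreal_le_iff)
  qed
  finally show ?thesis .
qed

text \<open>
  The sums over arbitrary injective choices of indices determine the Lorentz norm, since a near-optimal
  enumeration approximates each partial sum of \<open>\<Sum>\<^sub>i x\<^sup>*(i) v(i)\<close>. Boundedness of \<open>x\<close>, on which such
  enumerations depend, comes from the choice of a single index.
\<close>

lemma lorentz_sum_leI:
  assumes "C \<ge> 0"
    and le: "\<And>a N. inj_on a {1..N} \<Longrightarrow> 0 \<notin> a ` {1..N} \<Longrightarrow> (\<Sum>i=1..N. \<bar>x (a i)\<bar> * v i) \<le> C"
  shows "lorentz_sum x \<le> ennreal C"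
  unfolding lorentz_sum_def
proof (rule suminf_le_const)
  fix N
  have bounded: "\<bar>x k\<bar> \<le> C / v 1" if "k \<ge> 1" for k
    using le[of "\<lambda>_. k" 1] that v_1_pos by (simp add: pos_le_divide_eq)
  show "(\<Sum>j<N. rearr x (Suc j) * ennreal (v (Suc j))) \<le> ennreal C"
  proof (rule ennreal_le_epsilon)
    fix e :: real assume "e > 0"
    \<comment> \<open>The error \<open>\<epsilon>\<close> in each value adds up to \<open>\<epsilon> * Phi N\<close>; the summand 1 avoids division by 0.\<close>
    define \<epsilon> where "\<epsilon> = e / (Phi N + 1)"
    have "\<epsilon> > 0" using Phi_nonneg[of N] \<open>e > 0\<close> by (simp add: \<epsilon>_def)
    have "\<epsilon> * Phi N \<le> e" using Phi_nonneg[of N] \<open>e > 0\<close> by (simp add: \<epsilon>_def field_simps)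
    obtain a where "inj_on a {1..N} \<and> 0 \<notin> a ` {1..N} \<and>
        (\<forall>i\<in>{1..N}. rearr x i \<le> ennreal (\<bar>x (a i)\<bar> + \<epsilon>))"
      using near_optimal_enumeration[where N = N and y = x, OF bounded \<open>\<epsilon> > 0\<close>] ..
    then have a: "inj_on a {1..N}" "0 \<notin> a ` {1..N}"
      and near: "\<And>i. i \<in> {1..N} \<Longrightarrow> rearr x i \<le> ennreal (\<bar>x (a i)\<bar> + \<epsilon>)"
      by simp_all
    have "(\<Sum>j<N. rearr x (Suc j) * ennreal (v (Suc j))) = (\<Sum>i=1..N. rearr x i * ennreal (v i))"
      using sum.atLeast1_atMost_eq[of "\<lambda>i. rearr x i * ennreal (v i)" N] by simp
    also have "\<dots> \<le> (\<Sum>i=1..N. ennreal (\<bar>x (a i)\<bar> + \<epsilon>) * ennreal (v i))"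
      by (intro sum_mono mult_right_mono near) auto
    also have "\<dots> = (\<Sum>i=1..N. ennreal ((\<bar>x (a i)\<bar> + \<epsilon>) * v i))"
      using v_nonneg \<open>\<epsilon> > 0\<close> by (intro sum.cong refl ennreal_mult[symmetric]) auto
    also have "\<dots> = ennreal (\<Sum>i=1..N. (\<bar>x (a i)\<bar> + \<epsilon>) * v i)"
      using v_nonneg \<open>\<epsilon> > 0\<close> by (intro sum_ennreal mult_nonneg_nonneg) auto
    also have "(\<Sum>i=1..N. (\<bar>x (a i)\<bar> + \<epsilon>) * v i) = (\<Sum>i=1..N. \<bar>x (a i)\<bar> * v i) + \<epsilon> * Phi N"
      by (simp add: Phi_def distrib_right sum.distrib sum_distrib_left)
    also have "ennreal \<dots> \<le> ennreal (C + e)"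
      using le[OF a] \<open>\<epsilon> * Phi N \<le> e\<close> by (intro ennreal_leI add_mono)
    also have "\<dots> = ennreal C + ennreal e" using assms(1) \<open>e > 0\<close> by simp
    finally show "(\<Sum>j<N. rearr x (Suc j) * ennreal (v (Suc j))) \<le> ennreal C + ennreal e" .
  qed
qed simp

lemma dual_zero:
  assumes "f \<in> vecs (dual_space m0)"
  shows "f (\<lambda>_. 0) = 0"
proof (cases "(\<lambda>_. 0) \<in> vecs m0")
  case True
  then have "f (\<lambda>k. 0 * 0) = 0 * f (\<lambda>_. 0)"
    using assms unfolding dual_space_def linear_functional_on_def by fastforce
  then show ?thesis by simp
qed (use assms in \<open>simp add: dual_space_def\<close>)

end

text \<open>
  Unboundedness of the partial sums is what puts the finitely supported sequences into \<open>m\<^sub>\<psi>\<^sup>0\<close>.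
\<close>

locale unbounded_decreasing_weight = decreasing_weight +
  assumes Phi_unbounded: "filterlim Phi at_top sequentially"
begin

lemma finite_support_m0:
  assumes "y 0 = 0" "finite F" "\<And>k. k \<notin> F \<Longrightarrow> y k = 0"
  shows "y \<in> vecs m0"
  unfolding m0_iff
proof (intro conjI allI impI assms(1))
  fix \<epsilon> :: real assume "\<epsilon> > 0"
  define c where "c = (\<Sum>k\<in>F. \<bar>y k\<bar>)"
  have c: "subset_sums_le y n c" for n
    unfolding subset_sums_le_def
  proof (intro allI impI)
    fix A :: "nat set" assume "finite A"
    have "(\<Sum>k\<in>A. \<bar>y k\<bar>) = (\<Sum>k\<in>A \<inter> F. \<bar>y k\<bar>)"
      using assms(3) \<open>finite A\<close> by (intro sum.mono_neutral_right) auto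
    also have "\<dots> \<le> c" unfolding c_def using assms(2) by (intro sum_mono2) auto
    finally show "(\<Sum>k\<in>A. \<bar>y k\<bar>) \<le> c" .
  qed
  have "eventually (\<lambda>n. c / \<epsilon> \<le> Phi n) sequentially"
    using Phi_unbounded by (simp add: filterlim_at_top)
  then show "eventually (\<lambda>n. subset_sums_le y n (\<epsilon> * Phi n)) sequentially"
  proof eventually_elim
    case (elim n)
    then show ?case using \<open>\<epsilon> > 0\<close>
      by (intro subset_sums_le_mono[OF c order_refl]) (simp add: field_simps)
  qed
qed

lemma unit_vector_m0: "k \<ge> 1 \<Longrightarrow> indicator {k} \<in> vecs m0"
  by (rule finite_support_m0[where F = "{k}"]) (auto simp: indicator_def)

lemma dual_finite_support:
  assumes f: "f \<in> vecs (dual_space m0)"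
  shows "finite F \<Longrightarrow> 0 \<notin> F \<Longrightarrow> (\<And>k. k \<notin> F \<Longrightarrow> y k = 0) \<Longrightarrow>
           f y = (\<Sum>k\<in>F. y k * f (indicator {k}))"
proof (induction F arbitrary: y rule: finite_induct)
  case empty
  then have "y = (\<lambda>_. 0)" by auto
  then show ?case using dual_zero[OF f] by simp
next
  case (insert l F)
  define z where "z = y(l := 0)"
  have z: "z \<in> vecs m0"
    using insert.hyps insert.prems by (intro finite_support_m0[where F = F]) (auto simp: z_def)
  have l: "indicator {l} \<in> vecs m0"
    using insert.prems(1) by (intro unit_vector_m0) (auto simp: Suc_le_eq intro: gr0I)
  have lin: "linear_functional_on (vecs m0) f" using f by (simp add: dual_space_def)
  have "y = (\<lambda>k. z k + y l * indicator {l} k)"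
    by (auto simp: z_def indicator_def)
  then have "f y = f (\<lambda>k. z k + y l * indicator {l} k)" by simp
  also have "\<dots> = f z + f (\<lambda>k. y l * indicator {l} k)"
    by (rule linear_functional_on_add[OF lin z m0_scale[OF l]])
  also have "f (\<lambda>k. y l * indicator {l} k) = y l * f (indicator {l})"
    using lin l unfolding linear_functional_on_def by blast
  also have "f z = (\<Sum>k\<in>F. z k * f (indicator {k}))"
    using insert.prems by (intro insert.IH) (auto simp: z_def)
  also have "\<dots> = (\<Sum>k\<in>F. y k * f (indicator {k}))"
    using insert.hyps(2) by (intro sum.cong) (auto simp: z_def)
  finally show ?case using insert.hyps by (simp add: add.commute)
qed

text \<open>
  The functional is tested on the sequence with entry \<open>\<plusminus> v(i)\<close> at index \<open>a(i)\<close>, signs matching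
  those of \<open>f(e\<^bsub>a(i)\<^esub>)\<close>. Its norm is at most 1 because any \<open>n\<close> of its entries are, up to sign,
  values of \<open>v\<close> at different indices. The hypothesis speaks of the unit ball only, so that it
  covers both a bound of the form \<open>\<bar>f y\<bar> \<le> C \<parallel>y\<parallel>\<close> and the supremum that defines the dual norm.
\<close>

lemma lorentz_sum_coordinates_le:
  assumes f: "f \<in> vecs (dual_space m0)" and "C \<ge> 0"
    and le: "\<And>y. y \<in> vecs m0 \<Longrightarrow> nrm m0 y \<le> 1 \<Longrightarrow> \<bar>f y\<bar> \<le> C"
  shows "lorentz_sum (\<lambda>k. f (indicator {k})) \<le> ennreal C"
proof (rule lorentz_sum_leI[OF \<open>C \<ge> 0\<close>])
  fix a :: "nat \<Rightarrow> nat" and N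
  assume inj: "inj_on a {1..N}" and zero: "0 \<notin> a ` {1..N}"
  define F where "F = a ` {1..N}"
  \<comment> \<open>\<open>b\<close> recovers the position of an index in the enumeration \<open>a\<close>.\<close>
  define b where "b = the_inv_into {1..N} a"
  have b: "b (a i) = i" if "i \<in> {1..N}" for i
    using the_inv_into_f_f[OF inj that] by (simp add: b_def)
  define y where "y = (\<lambda>k. if k \<in> F then sgn (f (indicator {k})) * v (b k) else 0)"
  have F: "finite F" "0 \<notin> F" using zero by (auto simp: F_def)
  have y_m0: "y \<in> vecs m0"
    using F by (intro finite_support_m0[where F = F]) (auto simp: y_def)
  have "nrm m0 y \<le> 1"
  proof (rule m0_norm_leI)
    fix n :: nat
    show "subset_sums_le y n (1 * Phi n)"
      unfolding subset_sums_le_def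
    proof (intro allI impI)
      fix A :: "nat set" assume A: "finite A" "card A \<le> n"
      have inj_b: "inj_on b (A \<inter> F)" by (rule inj_onI) (auto simp: F_def b)
      have "(\<Sum>k\<in>A. \<bar>y k\<bar>) = (\<Sum>k\<in>A \<inter> F. \<bar>y k\<bar>)"
        using A(1) by (intro sum.mono_neutral_right) (auto simp: y_def)
      also have "\<dots> \<le> (\<Sum>k\<in>A \<inter> F. v (b k))"
      proof (rule sum_mono)
        fix k assume "k \<in> A \<inter> F"
        then have "k \<in> F" "0 \<le> v (b k)" by (auto simp: F_def b intro: v_nonneg)
        then show "\<bar>y k\<bar> \<le> v (b k)" by (auto simp: y_def abs_mult abs_sgn_eq)
      qed
      also have "\<dots> = sum v (b ` (A \<inter> F))" by (subst sum.reindex[OF inj_b]) (simp add: o_def)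
      also have "\<dots> \<le> Phi n"
      proof (rule sum_le_Phi)
        show "0 \<notin> b ` (A \<inter> F)" by (auto simp: F_def b)
        have "card (b ` (A \<inter> F)) \<le> card (A \<inter> F)" using A(1) by (intro card_image_le) auto
        also have "\<dots> \<le> card A" using A(1) by (intro card_mono) auto
        finally show "card (b ` (A \<inter> F)) \<le> n" using A(2) by simp
      qed (use A(1) in auto)
      finally show "(\<Sum>k\<in>A. \<bar>y k\<bar>) \<le> 1 * Phi n" by simp
    qed
  qed simp
  have "(\<Sum>i=1..N. \<bar>f (indicator {a i})\<bar> * v i) = (\<Sum>i=1..N. \<bar>f (indicator {a i})\<bar> * v (b (a i)))"
    by (intro sum.cong) (auto simp: b)
  also have "\<dots> = (\<Sum>k\<in>F. \<bar>f (indicator {k})\<bar> * v (b k))"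
    unfolding F_def by (subst sum.reindex[OF inj]) (simp add: o_def)
  also have "\<dots> = (\<Sum>k\<in>F. y k * f (indicator {k}))"
    by (intro sum.cong) (auto simp: y_def abs_sgn mult_ac)
  also have "\<dots> = f y"
    using dual_finite_support[OF f F, of y] by (simp add: y_def)
  also have "\<dots> \<le> C" using le[OF y_m0 \<open>nrm m0 y \<le> 1\<close>] by simp
  finally show "(\<Sum>i=1..N. \<bar>f (indicator {a i})\<bar> * v i) \<le> C" .
qed

text \<open>
  Two functionals that agree on unit vectors agree on finitely supported sequences, hence
  everywhere by density and continuity.
\<close>

lemma dual_eqI:
  assumes f: "f \<in> vecs (dual_space m0)" and g: "g \<in> vecs (dual_space m0)"
    and eq: "\<And>k. k \<ge> 1 \<Longrightarrow> f (indicator {k}) = g (indicator {k})"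
  shows "f = g"
proof
  fix y
  obtain C where C: "\<And>z. z \<in> vecs m0 \<Longrightarrow> \<bar>f z\<bar> \<le> C * nrm m0 z"
    using f by (auto simp: dual_space_def)
  obtain D where D: "\<And>z. z \<in> vecs m0 \<Longrightarrow> \<bar>g z\<bar> \<le> D * nrm m0 z"
    using g by (auto simp: dual_space_def)
  show "f y = g y"
  proof (cases "y \<in> vecs m0")
    case y: True
    have "\<bar>f y - g y\<bar> \<le> 0 + e" if "e > 0" for e
    proof -
      define K where "K = \<bar>C\<bar> + \<bar>D\<bar> + 1"
      have "K > 0" by (simp add: K_def)
      then obtain N where N: "nrm m0 (\<lambda>k. if k \<le> N then 0 else y k) \<le> e / K"
        using m0_tail_small[OF y, of "e / K"] \<open>e > 0\<close> by auto
      define t where "t = (\<lambda>k. if k \<le> N then 0 else y k)"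
      define h where "h = (\<lambda>k. if k \<le> N then y k else 0)"
      have t: "t \<in> vecs m0" by (rule m0_dominated[OF y]) (simp add: t_def)
      have h: "h \<in> vecs m0" by (rule m0_dominated[OF y]) (simp add: h_def)
      have split: "u y = u h + u t" if "u \<in> vecs (dual_space m0)" for u
      proof -
        have "y = (\<lambda>k. h k + t k)" by (auto simp: h_def t_def)
        then have "u y = u (\<lambda>k. h k + t k)" by simp
        also have "\<dots> = u h + u t"
          using that h t by (intro linear_functional_on_add[where V = "vecs m0"]) (simp_all add: dual_space_def)
        finally show ?thesis .
      qed
      have "h 0 = 0" using y by (simp add: h_def m0_iff)
      then have h_supp: "h k = 0" if "k \<notin> {1..N}" for k
        using that by (cases "k = 0") (auto simp: h_def)
      have "f h = g h"
        using dual_finite_support[OF f, of "{1..N}" h] dual_finite_support[OF g, of "{1..N}" h]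
          h_supp eq by simp
      then have "\<bar>f y - g y\<bar> = \<bar>f t - g t\<bar>" using split[OF f] split[OF g] by simp
      also have "\<dots> \<le> \<bar>f t\<bar> + \<bar>g t\<bar>" by (rule abs_triangle_ineq4)
      also have "\<dots> \<le> C * nrm m0 t + D * nrm m0 t" using C[OF t] D[OF t] by (rule add_mono)
      also have "\<dots> \<le> K * nrm m0 t"
        unfolding distrib_right[symmetric] by (rule mult_right_mono[OF _ m0_norm_nonneg]) (simp add: K_def)
      also have "\<dots> \<le> K * (e / K)" using N \<open>K > 0\<close> by (intro mult_left_mono) (auto simp: t_def)
      finally show ?thesis using \<open>K > 0\<close> by simp
    qed
    then have "\<bar>f y - g y\<bar> \<le> 0" by (rule field_le_epsilon)
    then show ?thesis by simp
  qed (use f g in \<open>simp add: dual_space_def\<close>)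
qed

text \<open>
  The value 0 outside \<open>m\<^sub>\<psi>\<^sup>0\<close> is the convention that makes functionals on \<open>m\<^sub>\<psi>\<^sup>0\<close> with equal
  restrictions equal as functions.
\<close>

definition pairing :: "(nat \<Rightarrow> real) \<Rightarrow> (nat \<Rightarrow> real) \<Rightarrow> real" where
  "pairing x y = (if y \<in> vecs m0 then (\<Sum>k. x k * y k) else 0)"

lemma summable_pairing:
  assumes x: "x \<in> vecs lorentz_space_v" and y: "y \<in> vecs m0"
  shows "summable (\<lambda>k. \<bar>x k * y k\<bar>)"
    and "(\<Sum>k. \<bar>x k * y k\<bar>) \<le> nrm lorentz_space_v x * nrm m0 y"
proof -
  have le: "(\<Sum>k<n. \<bar>x k * y k\<bar>) \<le> nrm lorentz_space_v x * nrm m0 y" for n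
  proof -
    have "(\<Sum>k<n. \<bar>x k * y k\<bar>) = (\<Sum>k\<in>{..<n} - {0}. \<bar>x k * y k\<bar>)"
      using y by (intro sum.mono_neutral_right) (auto simp: m0_iff)
    also have "\<dots> \<le> nrm lorentz_space_v x * nrm m0 y"
      using sum_mult_le_norms[OF _ y, of x "{..<n} - {0}"] x by (simp add: lorentz_space_v_def)
    finally show ?thesis .
  qed
  show summable: "summable (\<lambda>k. \<bar>x k * y k\<bar>)"
    by (rule summableI_nonneg_bounded[OF _ le]) simp
  show "(\<Sum>k. \<bar>x k * y k\<bar>) \<le> nrm lorentz_space_v x * nrm m0 y"
    by (rule suminf_le_const[OF summable le])
qed

lemma pairing_le:
  assumes "x \<in> vecs lorentz_space_v" "y \<in> vecs m0"
  shows "\<bar>pairing x y\<bar> \<le> nrm lorentz_space_v x * nrm m0 y"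
  using summable_rabs[OF summable_pairing(1)[OF assms]] summable_pairing(2)[OF assms] assms(2)
  by (simp add: pairing_def)

lemma pairing_dual:
  assumes x: "x \<in> vecs lorentz_space_v"
  shows "pairing x \<in> vecs (dual_space m0)"
proof -
  have summable: "summable (\<lambda>k. x k * y k)" if "y \<in> vecs m0" for y
    by (rule summable_rabs_cancel[OF summable_pairing(1)[OF x that]])
  have "linear_functional_on (vecs m0) (pairing x)"
    unfolding linear_functional_on_def
  proof (intro conjI ballI allI)
    fix y z assume "y \<in> vecs m0" "z \<in> vecs m0"
    then show "pairing x (\<lambda>k. y k + z k) = pairing x y + pairing x z"
      by (simp add: pairing_def m0_add distrib_left suminf_add[OF summable summable, symmetric])
  next
    fix c y assume "y \<in> vecs m0"
    then show "pairing x (\<lambda>k. c * y k) = c * pairing x y"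
      by (simp add: pairing_def m0_scale suminf_mult[OF summable] mult.left_commute)
  qed
  then show ?thesis
    using pairing_le[OF x] by (auto simp: dual_space_def pairing_def)
qed

lemma pairing_unit_vector:
  assumes "x 0 = 0"
  shows "pairing x (indicator {k}) = x k"
proof (cases "k = 0")
  case True
  then have "indicator {k} \<notin> vecs m0" by (simp add: m0_iff)
  then show ?thesis using True assms by (simp add: pairing_def)
next
  case False
  have "(\<Sum>j. x j * indicator {k} j) = (\<Sum>j\<in>{k}. x j * indicator {k} j)"
    by (rule suminf_finite) auto
  then show ?thesis using False unit_vector_m0[of k] by (simp add: pairing_def)
qed

lemma pairing_norm:
  assumes x: "x \<in> vecs lorentz_space_v"
  shows "nrm (dual_space m0) (pairing x) = nrm lorentz_space_v x"
proof -
  define S where "S = {\<bar>pairing x y\<bar> | y. y \<in> vecs m0 \<and> nrm m0 y \<le> 1}"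
  have le: "s \<le> nrm lorentz_space_v x" if "s \<in> S" for s
  proof -
    from that obtain y where y: "y \<in> vecs m0" "nrm m0 y \<le> 1" "s = \<bar>pairing x y\<bar>"
      by (auto simp: S_def)
    have "s \<le> nrm lorentz_space_v x * nrm m0 y" using pairing_le[OF x y(1)] y(3) by simp
    also have "\<dots> \<le> nrm lorentz_space_v x * 1"
      using y(2) by (intro mult_left_mono) (auto simp: lorentz_space_v_def)
    finally show ?thesis by simp
  qed
  then have bdd: "bdd_above S" by (auto simp: bdd_above_def)
  \<comment> \<open>A real supremum has its usual meaning only for nonempty sets.\<close>
  have zero: "0 \<in> S"
  proof -
    have "(\<lambda>_. 0) \<in> vecs m0" by (rule finite_support_m0[where F = "{}"]) auto
    moreover have "nrm m0 (\<lambda>_. 0) \<le> 0"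
      using Phi_nonneg by (intro m0_norm_leI) (auto simp: subset_sums_le_def)
    moreover have "\<bar>pairing x (\<lambda>_. 0)\<bar> = 0" by (simp add: pairing_def)
    ultimately show ?thesis unfolding S_def by force
  qed
  have "x 0 = 0" using x by (simp add: lorentz_space_v_def l0_def)
  have "lorentz_sum (\<lambda>k. pairing x (indicator {k})) \<le> ennreal (Sup S)"
    using cSup_upper[OF zero bdd] cSup_upper[OF _ bdd]
    by (intro lorentz_sum_coordinates_le[OF pairing_dual[OF x]]) (auto simp: S_def)
  then have "lorentz_sum x \<le> ennreal (Sup S)"
    by (simp add: pairing_unit_vector \<open>x 0 = 0\<close>)
  then have "nrm lorentz_space_v x \<le> Sup S"
    using cSup_upper[OF zero bdd] by (simp add: lorentz_space_v_def enn2real_leI)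
  moreover have "Sup S \<le> nrm lorentz_space_v x"
    using zero le by (intro cSup_least) auto
  ultimately show ?thesis by (simp add: dual_space_def S_def)
qed

text \<open>
  Surjectivity of the pairing. The vector \<open>indicator {0}\<close> is not a sequence in \<open>m\<^sub>\<psi>\<^sup>0\<close>, so \<open>f\<close>
  vanishes on it, and \<open>k \<mapsto> f (indicator {k})\<close> is automatically 0 at index 0.
\<close>

lemma coordinates_lorentz:
  assumes f: "f \<in> vecs (dual_space m0)"
  shows "(\<lambda>k. f (indicator {k})) \<in> vecs lorentz_space_v"
    and "pairing (\<lambda>k. f (indicator {k})) = f"
proof -
  have "indicator {0} \<notin> vecs m0" by (simp add: m0_iff)
  then have zero: "f (indicator {0}) = 0" using f by (simp add: dual_space_def)
  obtain C where C: "\<And>y. y \<in> vecs m0 \<Longrightarrow> \<bar>f y\<bar> \<le> C * nrm m0 y"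
    using f by (auto simp: dual_space_def)
  have "lorentz_sum (\<lambda>k. f (indicator {k})) \<le> ennreal \<bar>C\<bar>"
  proof (rule lorentz_sum_coordinates_le[OF f])
    fix y assume y: "y \<in> vecs m0" "nrm m0 y \<le> 1"
    have "\<bar>f y\<bar> \<le> \<bar>C\<bar> * nrm m0 y"
      using C[OF y(1)] mult_right_mono[OF abs_ge_self[of C] m0_norm_nonneg[of y]] by linarith
    also have "\<dots> \<le> \<bar>C\<bar> * 1" using y(2) by (intro mult_left_mono) auto
    finally show "\<bar>f y\<bar> \<le> \<bar>C\<bar>" by simp
  qed simp
  then have "lorentz_sum (\<lambda>k. f (indicator {k})) < \<infinity>" by (rule le_less_trans) simp
  with zero show mem: "(\<lambda>k. f (indicator {k})) \<in> vecs lorentz_space_v"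
    by (simp add: lorentz_space_v_def l0_def)
  show "pairing (\<lambda>k. f (indicator {k})) = f"
    by (rule dual_eqI[OF pairing_dual[OF mem] f]) (simp add: pairing_unit_vector zero)
qed

theorem isometry_pairing: "isometry_between lorentz_space_v (dual_space m0) pairing"
  unfolding isometry_between_def
proof (intro conjI ballI)
  have summable: "summable (\<lambda>k. x k * y k)" if "x \<in> vecs lorentz_space_v" "y \<in> vecs m0" for x y
    by (rule summable_rabs_cancel[OF summable_pairing(1)[OF that]])
  show "linear_map_on (vecs lorentz_space_v) pairing"
    unfolding linear_map_on_def
  proof (intro conjI ballI allI ext)
    fix x x' y assume "x \<in> vecs lorentz_space_v" "x' \<in> vecs lorentz_space_v"
    then show "pairing (\<lambda>k. x k + x' k) y = pairing x y + pairing x' y"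
      by (simp add: pairing_def distrib_right suminf_add[OF summable summable, symmetric])
  next
    fix c x y assume "x \<in> vecs lorentz_space_v"
    then show "pairing (\<lambda>k. c * x k) y = c * pairing x y"
      by (simp add: pairing_def suminf_mult[OF summable] mult.assoc)
  qed
  show "pairing ` vecs lorentz_space_v = vecs (dual_space m0)"
    using pairing_dual coordinates_lorentz by (metis (no_types, lifting) image_eqI image_subsetI subsetI subset_antisym)
qed (rule pairing_norm)

theorem isomorphism_coordinates:
  "isomorphism_between (dual_space m0) lorentz_space_v (\<lambda>f k. f (indicator {k}))"
proof -
  have norm: "nrm lorentz_space_v (\<lambda>k. f (indicator {k})) = nrm (dual_space m0) f"
    if "f \<in> vecs (dual_space m0)" for f
    using pairing_norm[OF coordinates_lorentz(1)[OF that]] coordinates_lorentz(2)[OF that] by simp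
  have zero_at_0: "x 0 = 0" if "x \<in> vecs lorentz_space_v" for x
    using that by (simp add: lorentz_space_v_def l0_def)
  have "bij_betw (\<lambda>f k. f (indicator {k})) (vecs (dual_space m0)) (vecs lorentz_space_v)"
    by (rule bij_betw_byWitness[where f' = pairing])
      (use coordinates_lorentz pairing_dual in \<open>auto simp: pairing_unit_vector zero_at_0\<close>)
  then show ?thesis
    unfolding isomorphism_between_def linear_map_on_def
    using norm by (auto intro!: exI[of _ 1])
qed

end


section \<open>The Lorentz space as a rearrangement sum with decreasing weight\<close>

definition tail_weight :: "(nat \<Rightarrow> real) \<Rightarrow> nat \<Rightarrow> real" where
  "tail_weight w i = (\<Sum>j. w (i + j) / real (i + j))"

text \<open>
  Finiteness of \<open>W\<^sub>1(1)\<close> bounds the series from index 2 on; finitely many terms do not matter.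
\<close>

lemma summable_tail_weight:
  assumes "weight_seq w"
  shows "summable (\<lambda>j. w (i + j) / real (i + j))"
proof -
  have "W1 w 1 < \<infinity>" using assms by (simp add: weight_seq_def)
  then have "(\<Sum>j. ennreal (w (j + 2) / real (j + 2))) \<noteq> top"
    by (simp add: W1_def add.commute)
  then have "summable (\<lambda>j. w (j + 2) / real (j + 2))"
    using assms by (intro summable_suminf_not_top) (auto simp: weight_seq_def)
  then have "summable (\<lambda>j. w j / real j)"
    by (subst (asm) summable_iff_shift[of "\<lambda>j. w j / real j" 2])
  then have "summable (\<lambda>j. w (j + i) / real (j + i))"
    by (subst summable_iff_shift[of "\<lambda>j. w j / real j" i])
  then show ?thesis by (simp add: add.commute)
qed

lemma ennreal_tail_weight:
  assumes "weight_seq w" "i \<ge> 1"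
  shows "ennreal (tail_weight w i) = (\<Sum>j. ennreal (w (i + j) / real (i + j)))"
  unfolding tail_weight_def using assms
  by (intro suminf_ennreal2[symmetric] summable_tail_weight) (auto simp: weight_seq_def)

lemma tail_weight_nonneg: "weight_seq w \<Longrightarrow> i \<ge> 1 \<Longrightarrow> 0 \<le> tail_weight w i"
  unfolding tail_weight_def by (intro suminf_nonneg summable_tail_weight) (auto simp: weight_seq_def)

lemma tail_weight_antimono:
  assumes "weight_seq w" "1 \<le> i" "i \<le> j"
  shows "tail_weight w j \<le> tail_weight w i"
  using assms(3)
proof (induction rule: dec_induct)
  case (step n)
  have "tail_weight w n = tail_weight w (Suc n) + w n / real n"
    unfolding tail_weight_def using suminf_split_head[OF summable_tail_weight[OF assms(1), of n]] by simp
  moreover have "0 \<le> w n / real n" using assms step by (simp add: weight_seq_def)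
  ultimately show ?case using step by linarith
qed simp

lemma tail_weight_1_pos:
  assumes "weight_seq w"
  shows "0 < tail_weight w 1"
proof -
  obtain n where n: "n \<ge> 1" "w n > 0" using assms by (auto simp: weight_seq_def)
  have "0 < w n / real n" using n by simp
  also have "\<dots> = (\<Sum>j\<in>{n - 1}. w (1 + j) / real (1 + j))" using n by simp
  also have "\<dots> \<le> tail_weight w 1"
    unfolding tail_weight_def using assms
    by (intro sum_le_suminf summable_tail_weight) (auto simp: weight_seq_def)
  finally show ?thesis .
qed

lemma suminf_swap_ennreal:
  fixes f :: "nat \<Rightarrow> nat \<Rightarrow> ennreal"
  shows "(\<Sum>i. \<Sum>j. f i j) = (\<Sum>j. \<Sum>i. f i j)"
  using nn_integral_suminf[of "\<lambda>j i. f i j" "count_space UNIV"]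
  by (simp add: nn_integral_count_space_nat)

text \<open>
  Tonelli: \<open>\<Sum>\<^sub>n (w(n)/n) \<Sum>\<^bsub>i\<le>n\<^esub> x\<^sup>*(i) = \<Sum>\<^sub>i x\<^sup>*(i) \<Sum>\<^bsub>n\<ge>i\<^esub> w(n)/n\<close>.
\<close>

lemma lorentz_norm_eq:
  assumes w: "weight_seq w"
  shows "lorentz_norm w x = (\<Sum>j. rearr x (Suc j) * ennreal (tail_weight w (Suc j)))"
proof -
  define g where "g j = ennreal (w (Suc j) / real (Suc j))" for j
  have "max_rearr x (j + 1) * ennreal (w (j + 1)) = (\<Sum>i. if i \<le> j then rearr x (Suc i) * g j else 0)" for j
  proof -
    have "ennreal (w (Suc j)) / of_nat (Suc j) = g j"
      using w unfolding g_def ennreal_of_nat_eq_real_of_nat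
      by (intro divide_ennreal) (auto simp: weight_seq_def)
    then have "max_rearr x (j + 1) * ennreal (w (j + 1)) = (\<Sum>i=1..Suc j. rearr x i) * g j"
      unfolding max_rearr_def by (simp only: ennreal_divide_times Suc_eq_plus1)
    also have "\<dots> = (\<Sum>i<Suc j. rearr x (Suc i)) * g j"
      by (simp only: sum.atLeast1_atMost_eq One_nat_def)
    also have "\<dots> = (\<Sum>i<Suc j. if i \<le> j then rearr x (Suc i) * g j else 0)"
      unfolding sum_distrib_right by (intro sum.cong) auto
    also have "\<dots> = (\<Sum>i. if i \<le> j then rearr x (Suc i) * g j else 0)"
      by (rule suminf_finite[symmetric]) auto
    finally show ?thesis .
  qed
  then have "lorentz_norm w x = (\<Sum>j. \<Sum>i. if i \<le> j then rearr x (Suc i) * g j else 0)"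
    unfolding lorentz_norm_def by (intro suminf_cong)
  also have "\<dots> = (\<Sum>i. \<Sum>j. if i \<le> j then rearr x (Suc i) * g j else 0)"
    by (rule suminf_swap_ennreal)
  also have "\<dots> = (\<Sum>i. rearr x (Suc i) * ennreal (tail_weight w (Suc i)))"
  proof (rule suminf_cong)
    fix i
    have "(\<Sum>j. if i \<le> j then rearr x (Suc i) * g j else 0) = (\<Sum>j. rearr x (Suc i) * g (j + i))"
      by (subst suminf_offset[of _ i]) (auto intro!: summableI)
    also have "\<dots> = rearr x (Suc i) * (\<Sum>j. g (j + i))" by simp
    also have "(\<Sum>j. g (j + i)) = ennreal (tail_weight w (Suc i))"
      by (subst ennreal_tail_weight[OF w]) (auto simp: g_def add.commute)
    finally show "(\<Sum>j. if i \<le> j then rearr x (Suc i) * g j else 0) =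
        rearr x (Suc i) * ennreal (tail_weight w (Suc i))" .
  qed
  finally show ?thesis .
qed

lemma sum_ennreal_tail_weight:
  assumes "weight_seq w"
  shows "(\<Sum>j<n. ennreal (tail_weight w (Suc j))) = ennreal (\<Sum>i=1..n. tail_weight w i)"
  using sum.atLeast1_atMost_eq[of "tail_weight w" n] tail_weight_nonneg[OF assms] by simp

lemma lorentz_norm_indicator:
  assumes "weight_seq w"
  shows "lorentz_norm w (indicator {1..n}) = ennreal (\<Sum>i=1..n. tail_weight w i)"
proof -
  have "lorentz_norm w (indicator {1..n}) =
          (\<Sum>j. if j < n then ennreal (tail_weight w (Suc j)) else 0)"
    unfolding lorentz_norm_eq[OF assms] by (intro suminf_cong) (simp add: rearr_indicator)
  also have "\<dots> = (\<Sum>j<n. if j < n then ennreal (tail_weight w (Suc j)) else 0)"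
    by (rule suminf_finite) auto
  also have "\<dots> = (\<Sum>j<n. ennreal (tail_weight w (Suc j)))" by (intro sum.cong) auto
  finally show ?thesis unfolding sum_ennreal_tail_weight[OF assms] .
qed

lemma fund_seq_eq:
  assumes "weight_seq w"
  shows "fund_seq w n = (\<Sum>i=1..n. tail_weight w i)"
proof -
  have "{i. 1 \<le> i \<and> i \<le> n} = {1..n}" by auto
  moreover have "0 \<le> (\<Sum>i=1..n. tail_weight w i)"
    by (intro sum_nonneg tail_weight_nonneg[OF assms]) simp
  ultimately show ?thesis
    using lorentz_norm_indicator[OF assms, of n] by (simp add: fund_seq_def lorentz_space_def)
qed

text \<open>
  The constant sequence 1 equals its rearrangement and its averages, so \<open>W(\<infinity>)\<close> is its Lorentz
  norm, and the rearrangement form of that norm gives the other series.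
\<close>

lemma W_infinity_eq:
  assumes "weight_seq w"
  shows "W_infinity w = (\<Sum>j. ennreal (tail_weight w (Suc j)))"
proof -
  have one: "rearr (indicator {1..}) i = 1" if "i \<ge> 1" for i
    using that rearr_indicator[of "{1..}" i] by (simp add: infinite_Ici)
  have "max_rearr (indicator {1..}) (Suc j) = 1" for j
  proof -
    have "(\<Sum>i=1..Suc j. rearr (indicator {1..}) i) = (\<Sum>i=1..Suc j. 1)"
      by (intro sum.cong one) auto
    then show ?thesis
      unfolding max_rearr_def by (simp add: ennreal_of_nat_eq_real_of_nat divide_ennreal del: of_nat_Suc)
  qed
  then have "W_infinity w = lorentz_norm w (indicator {1..})"
    by (simp add: W_infinity_def lorentz_norm_def)
  also have "\<dots> = (\<Sum>j. ennreal (tail_weight w (Suc j)))"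
    unfolding lorentz_norm_eq[OF assms] by (intro suminf_cong) (subst one, simp_all)
  finally show ?thesis .
qed

lemma W_infinity_top_iff:
  assumes "weight_seq w"
  shows "W_infinity w = \<infinity> \<longleftrightarrow> (\<forall>B. \<exists>n. B < (\<Sum>i=1..n. tail_weight w i))"
proof
  assume top: "W_infinity w = \<infinity>"
  show "\<forall>B. \<exists>n. B < (\<Sum>i=1..n. tail_weight w i)"
  proof (rule ccontr)
    assume "\<not> ?thesis"
    then obtain B where B: "\<And>n. (\<Sum>i=1..n. tail_weight w i) \<le> B" by (meson not_le)
    have "W_infinity w \<le> ennreal B"
      unfolding W_infinity_eq[OF assms]
      by (rule suminf_le_const) (auto simp only: sum_ennreal_tail_weight[OF assms] intro!: ennreal_leI B summableI)
    then show False using top by (simp add: top_unique)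
  qed
next
  assume unb: "\<forall>B. \<exists>n. B < (\<Sum>i=1..n. tail_weight w i)"
  show "W_infinity w = \<infinity>"
  proof (rule ccontr)
    assume "W_infinity w \<noteq> \<infinity>"
    then obtain B where B: "B \<ge> 0" "W_infinity w = ennreal B"
      by (cases "W_infinity w") auto
    from unb obtain n where n: "B < (\<Sum>i=1..n. tail_weight w i)" by blast
    have "ennreal (\<Sum>i=1..n. tail_weight w i) \<le> W_infinity w"
      unfolding W_infinity_eq[OF assms] sum_ennreal_tail_weight[OF assms, symmetric]
      by (rule sum_le_suminf) (auto intro: summableI)
    then show False using n B by (simp add: ennreal_le_iff)
  qed
qed

text \<open>
  Two distinct members, which rule out a bijection with the zero space.
\<close>

lemma lorentz_space_nontrivial:
  assumes "weight_seq w"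
  shows "indicator {} \<in> vecs (lorentz_space w)" "indicator {1} \<in> vecs (lorentz_space w)"
  using lorentz_norm_indicator[OF assms, of 0] lorentz_norm_indicator[OF assms, of 1]
  by (simp_all add: lorentz_space_def l0_def)

section \<open>The predual of the Lorentz space\<close>

theorem theorem5p2:
  fixes w \<psi> :: "nat \<Rightarrow> real"
  assumes "weight_seq w"
    and "\<And>n. n \<ge> 1 \<Longrightarrow> \<psi> n = real n / fund_seq w n"
  shows "(predual (marcinkiewicz_space0 \<psi>) (lorentz_space w) \<longleftrightarrow> W_infinity w = \<infinity>) \<and>
         (W_infinity w = \<infinity> \<longrightarrow>
            (\<exists>T. isometry_between (lorentz_space w) (dual_space (marcinkiewicz_space0 \<psi>)) T))"
proof -
  interpret decreasing_weight "tail_weight w" \<psi>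
    using assms(2) fund_seq_eq[OF assms(1)] tail_weight_nonneg[OF assms(1)]
      tail_weight_antimono[OF assms(1)] tail_weight_1_pos[OF assms(1)]
    by unfold_locales auto
  have space_eq: "lorentz_space w = lorentz_space_v"
    by (simp add: lorentz_space_def lorentz_space_v_def lorentz_norm_eq[OF assms(1)] lorentz_sum_def)
  show ?thesis
  proof (cases "W_infinity w = \<infinity>")
    case True
    have "filterlim Phi at_top sequentially"
      unfolding filterlim_at_top
    proof
      fix B
      obtain n where "B < Phi n"
        using True W_infinity_top_iff[OF assms(1)] by (auto simp: Phi_def)
      then have "B \<le> Phi m" if "m \<ge> n" for m using Phi_mono[OF that] by linarith
      then show "eventually (\<lambda>m. B \<le> Phi m) sequentially"
        by (auto simp: eventually_sequentially)
    qed
    then interpret unbounded_decreasing_weight "tail_weight w" \<psi>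
      by unfold_locales
    show ?thesis
      unfolding predual_def space_eq using True isomorphism_coordinates isometry_pairing by blast
  next
    case False
    then obtain B where B: "\<And>n. Phi n \<le> B"
      unfolding W_infinity_top_iff[OF assms(1)] Phi_def by (meson not_le)
    have "\<not> predual m0 (lorentz_space w)"
    proof
      assume "predual m0 (lorentz_space w)"
      then obtain T where T: "bij_betw T (vecs (dual_space m0)) (vecs (lorentz_space w))"
        by (auto simp: predual_def isomorphism_between_def)
      have dual_trivial: "f = (\<lambda>_. 0)" if f: "f \<in> vecs (dual_space m0)" for f
      proof
        fix y
        show "f y = 0"
        proof (cases "y \<in> vecs m0")
          case True
          then show ?thesis using m0_trivial_if_bounded[OF B True] dual_zero[OF f] by simp
        qed (use f in \<open>simp add: dual_space_def\<close>)
      qed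
      obtain f where f: "f \<in> vecs (dual_space m0)" "T f = indicator {}"
        using lorentz_space_nontrivial(1)[OF assms(1)] unfolding bij_betw_imp_surj_on[OF T, symmetric]
        by (metis imageE)
      obtain g where g: "g \<in> vecs (dual_space m0)" "T g = indicator {1}"
        using lorentz_space_nontrivial(2)[OF assms(1)] unfolding bij_betw_imp_surj_on[OF T, symmetric]
        by (metis imageE)
      have "(indicator {} :: nat \<Rightarrow> real) 1 = indicator {1} (1::nat)"
        using f g dual_trivial by metis
      then show False by simp
    qed
    with False show ?thesis by simp
  qed
qed

end
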